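(* Let $X$ be a finite skew brace, let $L_\infty(X)$ be the final term of its left series, and let $\gamma_\infty(X^2,+)$ denote the nilpotent residual of the group $(X^2,+)$, where $X^2=X*X$. Then $L_\infty(X)$ is normal in $(X,+)$ if and only if $$\gamma_\infty(X^2,+)\le L_\infty(X).$$
   Context: A skew (left) brace is a triple $X=(X,+,\cdot)$ such that $(X,+)$ and $(X,\cdot)$ are groups (not necessarily abelian) on the same set and $a\cdot(b+c)=a\cdot b-a+a\cdot c$ for all $a,b,c\in X$. The star product is $a*b=-a+a\cdot b-b$; for subsets $S,T\subseteq X$, $S*T$ denotes the subgroup of $(X,+)$ generated by all $s*t$ with $s\in S$, $t\in T$. The left series of $X$ is $X^1=X$, $X^{n+1}=X*X^n$ for $n\ge1$, a descending chain of subgroups of $(X,+)$. Its final term is $L_\infty(X)=\bigcap_{n\ge1}X^n$. For a finite group $H$, the nilpotent residual $\gamma_\infty(H)$ is the smallest normal subgroup of $H$ with nilpotent quotient (the final term of the lower central series). *)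

theory Defs
  imports "HOL-Algebra.Ring" "HOL-Algebra.Coset" "HOL-Algebra.Generated_Groups"
begin

text \<open>
  A skew brace is carried by the library's ring record: \<open>add_monoid B\<close> is the group
  \<open>(B, +)\<close>, which need not be abelian, and \<open>B\<close> itself, read as a monoid, is
  the group \<open>(B, \<cdot>)\<close>. The identities of the two groups coincide as a consequence
  of the axioms.
\<close>

locale skew_brace = group B + add: group "add_monoid B"
  for B :: "('a, 'm) ring_scheme" (structure) +
  assumes brace_distrib:
    "\<lbrakk>a \<in> carrier B; b \<in> carrier B; c \<in> carrier B\<rbrakk>
      \<Longrightarrow> a \<otimes> (b \<oplus> c) = ((a \<otimes> b) \<oplus> (\<ominus> a)) \<oplus> (a \<otimes> c)"

definition star :: "('a, 'm) ring_scheme \<Rightarrow> 'a \<Rightarrow> 'a \<Rightarrow> 'a" where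
  "star B a b = ((\<ominus>\<^bsub>B\<^esub> a) \<oplus>\<^bsub>B\<^esub> (a \<otimes>\<^bsub>B\<^esub> b)) \<oplus>\<^bsub>B\<^esub> (\<ominus>\<^bsub>B\<^esub> b)"

definition set_star :: "('a, 'm) ring_scheme \<Rightarrow> 'a set \<Rightarrow> 'a set \<Rightarrow> 'a set" where
  "set_star B S T = generate (add_monoid B) {star B s t | s t. s \<in> S \<and> t \<in> T}"

text \<open>The left series is indexed from 1; the value at 0 is a dummy.\<close>

fun left_series :: "('a, 'm) ring_scheme \<Rightarrow> nat \<Rightarrow> 'a set" where
  "left_series B 0 = carrier B"
| "left_series B (Suc 0) = carrier B"
| "left_series B (Suc (Suc n)) = set_star B (carrier B) (left_series B (Suc n))"

definition left_series_limit :: "('a, 'm) ring_scheme \<Rightarrow> 'a set" where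
  "left_series_limit B = (\<Inter>n\<in>{1..}. left_series B n)"

primrec lower_central :: "('a, 'm) monoid_scheme \<Rightarrow> nat \<Rightarrow> 'a set" where
  "lower_central G 0 = carrier G"
| "lower_central G (Suc n) = generate G
     {x \<otimes>\<^bsub>G\<^esub> y \<otimes>\<^bsub>G\<^esub> inv\<^bsub>G\<^esub> x \<otimes>\<^bsub>G\<^esub> inv\<^bsub>G\<^esub> y | x y. x \<in> lower_central G n \<and> y \<in> carrier G}"

definition nilpotent_group :: "('a, 'm) monoid_scheme \<Rightarrow> bool" where
  "nilpotent_group G \<longleftrightarrow> group G \<and> (\<exists>n. lower_central G n = {\<one>\<^bsub>G\<^esub>})"

text \<open>The least element exists when \<open>G\<close> is finite; otherwise it may not.\<close>

definition nilpotent_residual :: "('a, 'm) monoid_scheme \<Rightarrow> 'a set" where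
  "nilpotent_residual G = (LEAST N. N \<lhd> G \<and> nilpotent_group (G Mod N))"

end

theory Submission
  imports Defs
begin

text \<open>
  The multiplicative group acts on the additive one by \<open>\<lambda>\<^sub>a(b) = -a + a \<cdot> b\<close>, and the star
  product is \<open>\<lambda>\<^sub>a(b) - b\<close>, so the left series is the iterated commutator series of the
  additive group \<open>G\<close> with its operator group \<open>A\<close>. The statement is proved for every finite group
  \<open>G\<close> with a group \<open>A\<close> of operators. Write \<open>X\<^sub>0 = G\<close> and \<open>X\<^sub>k\<^sub>+\<^sub>1 = [X\<^sub>k, A]\<close>, let \<open>L\<close> be the
  final term and \<open>N = X\<^sub>1\<close>; since the lower central series of \<open>N\<close> becomes stationary at the
  residual, the claim is that \<open>L\<close> is normal in \<open>G\<close> iff \<open>\<gamma>\<^sub>m(N) \<le> L\<close> for some \<open>m\<close>.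
  
  The two actions on \<open>G\<close>, by operators and by conjugation, are treated at once through the
  semidirect product, which acts by \<open>(x, g) v = x g(v) x\<^sup>-\<^sup>1\<close>. Its subgroups \<open>D\<^sub>k = X\<^sub>k \<rtimes> A\<close> form a
  chain, each normal in the preceding one, so that \<open>A\<close> is subnormal modulo \<open>L\<close>.
  
  If \<open>L\<close> is normal, \<open>D\<^sub>n\<close> (where \<open>X\<^sub>n = L\<close>) acts nilpotently on \<open>G\<close> modulo \<open>L\<close>. A Fitting
  argument (\<open>nil_mod_generate\<close>) shows that the normal subgroups of a given operator group that
  act nilpotently modulo \<open>L\<close> generate a subgroup, the nil radical, which still does so. The
  radical of a normal subgroup lies in the radical of the whole group, hence \<open>A\<close> is contained in
  the radical of \<open>D\<^sub>n\<close>, of \<open>D\<^sub>n\<^sub>-\<^sub>1\<close>, and finally of \<open>D\<^sub>0\<close>. That radical is normal in \<open>D\<^sub>0\<close>, so it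
  contains all \<open>x g(x)\<^sup>-\<^sup>1\<close>, that is, \<open>N\<close>. Thus \<open>N\<close> acts nilpotently by conjugation modulo \<open>L\<close>,
  which says \<open>\<gamma>\<^sub>m(N) \<le> L\<close> (\<open>lower_central_subset_limit\<close>).
  
  Conversely, let \<open>\<gamma>\<^sub>m(N) \<le> L\<close>. Starting from \<open>X\<^sub>n = L\<close>, suppose \<open>L\<close> is normalised by \<open>X\<^sub>k\<^sub>+\<^sub>1\<close>,
  and let \<open>T\<close> be the final term of the series of \<open>X\<^sub>k\<close> under \<open>D\<^sub>k\<^sub>+\<^sub>1\<close>. It contains \<open>L\<close>, and it is
  normalised by \<open>X\<^sub>k\<close> because \<open>D\<^sub>k\<^sub>+\<^sub>1\<close> is normal in \<open>D\<^sub>k\<close>. From \<open>T \<le> L \<gamma>\<^sub>i(N)\<close> one gets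
  \<open>T = [T, D\<^sub>k\<^sub>+\<^sub>1] \<le> [T, A] L \<gamma>\<^sub>i\<^sub>+\<^sub>1(N)\<close>, and iterating the operators pushes \<open>T\<close> down to
  \<open>X\<^sub>j \<gamma>\<^sub>i\<^sub>+\<^sub>1(N)\<close> for all \<open>j\<close>, that is, to \<open>L \<gamma>\<^sub>i\<^sub>+\<^sub>1(N)\<close>. So \<open>T = L\<close> and \<open>X\<^sub>k\<close> normalises
  \<open>L\<close> (\<open>limit_normal\<close>).
\<close>

section \<open>Normalised subgroups and their products\<close>

lemma decreasing_sets_stabilize:
  fixes f :: "nat \<Rightarrow> 'c set"
  assumes "\<And>n. f (Suc n) \<subseteq> f n" and "finite (f 0)"
  obtains n where "\<And>m. n \<le> m \<Longrightarrow> f m = f n"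
proof -
  have anti: "f m \<subseteq> f n" if "n \<le> m" for m n
    using lift_Suc_antimono_le[of f, OF assms(1) that] .
  have fin: "finite (f n)" for n
    using anti[of 0 n] assms(2) finite_subset by auto
  obtain n where "\<forall>m. card (f n) \<le> card (f m)"
    using ex_has_least_nat[of "\<lambda>_. True" 0 "\<lambda>n. card (f n)"] by auto
  then have "f m = f n" if "n \<le> m" for m
    using card_seteq[OF fin anti[OF that]] by simp
  then show thesis by (rule that)
qed

context group
begin

text \<open>
  The normalising subgroup often does not contain the normalised one, and both live in one ambient
  group; hence a relation between sets rather than \<open>\<lhd>\<close> in a restricted group.
\<close>

definition normalizes :: "'a set \<Rightarrow> 'a set \<Rightarrow> bool" where
  "normalizes U S \<longleftrightarrow> (\<forall>u\<in>U. \<forall>s\<in>S. u \<otimes> s \<otimes> inv u \<in> S)"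

lemma normalizesD: "normalizes U S \<Longrightarrow> u \<in> U \<Longrightarrow> s \<in> S \<Longrightarrow> u \<otimes> s \<otimes> inv u \<in> S"
  by (simp add: normalizes_def)

lemma normalizes_subset: "normalizes V S \<Longrightarrow> U \<subseteq> V \<Longrightarrow> normalizes U S"
  by (auto simp: normalizes_def)

lemma subgroup_normalizes_self:
  assumes "subgroup D G" shows "normalizes D D"
  using subgroup.m_closed[OF assms] subgroup.m_inv_closed[OF assms]
  unfolding normalizes_def by simp

lemma normal_iff_normalizes: "N \<lhd> G \<longleftrightarrow> subgroup N G \<and> normalizes (carrier G) N"
  by (auto simp: normal_inv_iff normalizes_def)

lemma inv_cancel_left:
  assumes "x \<in> carrier G" "y \<in> carrier G"
  shows "x \<otimes> (inv x \<otimes> y) = y" "inv x \<otimes> (x \<otimes> y) = y"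
  using assms by (simp_all add: m_assoc[symmetric])

lemmas group_word = m_assoc inv_mult_group inv_cancel_left

lemma subgroup_mult_normalized:
  assumes U: "subgroup U G" and S: "subgroup S G" and norm: "normalizes U S"
  shows "subgroup (U <#> S) G"
proof (rule subgroupI)
  show "U <#> S \<subseteq> carrier G"
    using U S by (simp add: setmult_subset_G subgroup.subset)
  show "U <#> S \<noteq> {}"
    using U S by (auto simp: set_mult_def dest: subgroup.one_closed)
next
  fix a assume "a \<in> U <#> S"
  then obtain u s where us: "u \<in> U" "s \<in> S" "a = u \<otimes> s" by (auto simp: set_mult_def)
  have c: "u \<in> carrier G" "s \<in> carrier G" using us U S subgroup.mem_carrier by fast+
  have "inv a = inv u \<otimes> (u \<otimes> inv s \<otimes> inv u)"
    using c by (simp add: us(3) group_word)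
  moreover have "u \<otimes> inv s \<otimes> inv u \<in> S"
    using norm us S by (meson normalizesD subgroup.m_inv_closed)
  moreover have "inv u \<in> U" using us U by (simp add: subgroup.m_inv_closed)
  ultimately show "inv a \<in> U <#> S" by (auto simp: set_mult_def)
next
  fix a b assume "a \<in> U <#> S" "b \<in> U <#> S"
  then obtain u s v r where us: "u \<in> U" "s \<in> S" "a = u \<otimes> s" "v \<in> U" "r \<in> S" "b = v \<otimes> r"
    by (auto simp: set_mult_def)
  have c: "u \<in> carrier G" "s \<in> carrier G" "v \<in> carrier G" "r \<in> carrier G"
    using us U S subgroup.mem_carrier by fast+
  have iv: "inv v \<in> U" using us U by (simp add: subgroup.m_inv_closed)
  have "a \<otimes> b = (u \<otimes> v) \<otimes> ((inv v \<otimes> s \<otimes> inv (inv v)) \<otimes> r)"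
    using c by (simp add: us group_word)
  moreover have "(inv v \<otimes> s \<otimes> inv (inv v)) \<otimes> r \<in> S"
    using normalizesD[OF norm iv us(2)] us S by (simp add: subgroup.m_closed)
  moreover have "u \<otimes> v \<in> U" using us U by (simp add: subgroup.m_closed)
  ultimately show "a \<otimes> b \<in> U <#> S" by (auto simp: set_mult_def)
qed

lemma set_mult_incl:
  assumes "subgroup U G" "subgroup S G"
  shows "U \<subseteq> U <#> S" "S \<subseteq> U <#> S"
proof -
  have "u = u \<otimes> \<one>" if "u \<in> U" for u using that assms subgroup.mem_carrier by fastforce
  then show "U \<subseteq> U <#> S"
    using assms(2) subgroup.one_closed unfolding set_mult_def by fastforce
  have "s = \<one> \<otimes> s" if "s \<in> S" for s using that assms subgroup.mem_carrier by fastforce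
  then show "S \<subseteq> U <#> S"
    using assms(1) subgroup.one_closed unfolding set_mult_def by fastforce
qed

lemma set_mult_memI: "u \<in> U \<Longrightarrow> s \<in> S \<Longrightarrow> u \<otimes> s \<in> U <#> S"
  by (auto simp: set_mult_def)

lemma set_mult_memE:
  assumes "x \<in> U <#> S" obtains u s where "u \<in> U" "s \<in> S" "x = u \<otimes> s"
  using assms by (auto simp: set_mult_def)

text \<open>
  Conjugation by a fixed element is a homomorphism, so it suffices to test the generators.
\<close>

lemma generate_normalizes:
  assumes K: "K \<subseteq> carrier G" and U: "U \<subseteq> carrier G"
    and gen: "\<And>u k. u \<in> U \<Longrightarrow> k \<in> K \<Longrightarrow> u \<otimes> k \<otimes> inv u \<in> generate G K"
  shows "normalizes U (generate G K)"
  unfolding normalizes_def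
proof (intro ballI)
  fix u s assume u: "u \<in> U" and s: "s \<in> generate G K"
  have uc: "u \<in> carrier G" using u U by blast
  have sub: "subgroup (generate G K) G" by (rule generate_is_subgroup[OF K])
  show "u \<otimes> s \<otimes> inv u \<in> generate G K"
    using s
  proof (induction rule: generate.induct)
    case one
    then show ?case using uc by (simp add: generate.one)
  next
    case (incl h)
    then show ?case using gen u by blast
  next
    case (inv h)
    have "h \<in> carrier G" using inv K by blast
    then have "u \<otimes> inv h \<otimes> inv u = inv (u \<otimes> h \<otimes> inv u)"
      using uc by (simp add: group_word)
    then show ?case using gen[OF u inv] subgroup.m_inv_closed[OF sub] by simp
  next
    case (eng h1 h2)
    have "h1 \<in> carrier G" "h2 \<in> carrier G"
      using eng subgroup.mem_carrier[OF sub] by auto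
    then have "u \<otimes> (h1 \<otimes> h2) \<otimes> inv u = (u \<otimes> h1 \<otimes> inv u) \<otimes> (u \<otimes> h2 \<otimes> inv u)"
      using uc by (simp add: group_word)
    then show ?case using eng.IH subgroup.m_closed[OF sub] by simp
  qed
qed

lemma normalizes_set_mult:
  assumes "normalizes V U" "normalizes V S"
    and "V \<subseteq> carrier G" "U \<subseteq> carrier G" "S \<subseteq> carrier G"
  shows "normalizes V (U <#> S)"
  unfolding normalizes_def
proof (intro ballI)
  fix v x assume v: "v \<in> V" and "x \<in> U <#> S"
  then obtain u s where us: "u \<in> U" "s \<in> S" "x = u \<otimes> s" by (elim set_mult_memE)
  have c: "v \<in> carrier G" "u \<in> carrier G" "s \<in> carrier G" using assms(3-5) v us by auto
  have "v \<otimes> x \<otimes> inv v = (v \<otimes> u \<otimes> inv v) \<otimes> (v \<otimes> s \<otimes> inv v)"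
    using c by (simp add: us(3) group_word)
  then show "v \<otimes> x \<otimes> inv v \<in> U <#> S"
    using normalizesD[OF assms(1) v us(1)] normalizesD[OF assms(2) v us(2)]
    by (simp add: set_mult_memI)
qed

lemma set_mult_least:
  assumes "subgroup H G" "U \<subseteq> H" "S \<subseteq> H"
  shows "U <#> S \<subseteq> H"
  using assms(2,3) subgroup.m_closed[OF assms(1)] by (auto simp: set_mult_def)

lemma conjugation_hom:
  assumes "f \<in> carrier G" shows "(\<lambda>k. f \<otimes> k \<otimes> inv f) \<in> hom G G"
  using assms by (auto simp: hom_def group_word)

end

section \<open>Groups with operators\<close>

locale operator_group = group G + A: group A
  for G :: "('a, 'm) monoid_scheme" (structure) and A :: "('b, 'n) monoid_scheme" +
  fixes act :: "'b \<Rightarrow> 'a \<Rightarrow> 'a"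
  assumes act_hom: "a \<in> carrier A \<Longrightarrow> act a \<in> hom G G"
    and act_one: "x \<in> carrier G \<Longrightarrow> act \<one>\<^bsub>A\<^esub> x = x"
    and act_compose: "\<lbrakk>a \<in> carrier A; b \<in> carrier A; x \<in> carrier G\<rbrakk>
      \<Longrightarrow> act (a \<otimes>\<^bsub>A\<^esub> b) x = act a (act b x)"
begin

lemma act_closed [simp]: "a \<in> carrier A \<Longrightarrow> x \<in> carrier G \<Longrightarrow> act a x \<in> carrier G"
  by (rule hom_in_carrier[OF act_hom])

lemma act_mult [simp]:
  "\<lbrakk>a \<in> carrier A; x \<in> carrier G; y \<in> carrier G\<rbrakk> \<Longrightarrow> act a (x \<otimes> y) = act a x \<otimes> act a y"
  by (rule hom_mult[OF act_hom])

lemma act_inv [simp]: "a \<in> carrier A \<Longrightarrow> x \<in> carrier G \<Longrightarrow> act a (inv x) = inv (act a x)"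
  using group_hom.hom_inv[of G G "act a" x] act_hom
  by (simp add: group_hom_def group_hom_axioms_def)

lemma act_cancel [simp]:
  assumes "a \<in> carrier A" "x \<in> carrier G"
  shows "act (inv\<^bsub>A\<^esub> a) (act a x) = x" "act a (act (inv\<^bsub>A\<^esub> a) x) = x"
  using assms by (simp_all add: act_compose[symmetric] act_one)

definition invariant :: "'b set \<Rightarrow> 'a set \<Rightarrow> bool" where
  "invariant D T \<longleftrightarrow> (\<forall>d\<in>D. \<forall>t\<in>T. act d t \<in> T)"

lemma invariantD: "invariant D T \<Longrightarrow> d \<in> D \<Longrightarrow> t \<in> T \<Longrightarrow> act d t \<in> T"
  by (simp add: invariant_def)

lemma invariant_subset: "invariant E T \<Longrightarrow> D \<subseteq> E \<Longrightarrow> invariant D T"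
  by (auto simp: invariant_def)

lemma invariant_carrier: "D \<subseteq> carrier A \<Longrightarrow> invariant D (carrier G)"
  by (auto simp: invariant_def)

lemma invariant_Int: "invariant D S \<Longrightarrow> invariant D T \<Longrightarrow> invariant D (S \<inter> T)"
  by (auto simp: invariant_def)

lemma invariant_set_mult:
  assumes "invariant D U" "invariant D S" "D \<subseteq> carrier A" "U \<subseteq> carrier G" "S \<subseteq> carrier G"
  shows "invariant D (U <#> S)"
  unfolding invariant_def
proof (intro ballI)
  fix d x assume d: "d \<in> D" and "x \<in> U <#> S"
  then obtain u s where "u \<in> U" "s \<in> S" "x = u \<otimes> s" by (elim set_mult_memE)
  moreover from this have "act d x = act d u \<otimes> act d s" using assms d by (auto intro!: act_mult)
  ultimately show "act d x \<in> U <#> S"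
    using assms(1,2) d by (simp add: invariantD set_mult_memI)
qed

lemma invariant_generate:
  assumes K: "K \<subseteq> carrier G" and D: "D \<subseteq> carrier A"
    and gen: "\<And>d k. d \<in> D \<Longrightarrow> k \<in> K \<Longrightarrow> act d k \<in> generate G K"
  shows "invariant D (generate G K)"
  unfolding invariant_def
proof (intro ballI)
  fix d x assume d: "d \<in> D" and x: "x \<in> generate G K"
  have dA: "d \<in> carrier A" using d D by blast
  then interpret h: group_hom G G "act d"
    using act_hom by unfold_locales
  have "act d x \<in> generate G (act d ` K)"
    using h.generate_img[OF K] x by blast
  also have "\<dots> \<subseteq> generate G K"
    using gen d by (intro generate_subgroup_incl generate_is_subgroup K) auto
  finally show "act d x \<in> generate G K" .
qed

definition commutator :: "'a set \<Rightarrow> 'b set \<Rightarrow> 'a set" where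
  "commutator T D = generate G {act d t \<otimes> inv t | d t. d \<in> D \<and> t \<in> T}"

lemma commutator_generators_closed:
  "T \<subseteq> carrier G \<Longrightarrow> D \<subseteq> carrier A \<Longrightarrow> {act d t \<otimes> inv t | d t. d \<in> D \<and> t \<in> T} \<subseteq> carrier G"
  by (auto intro!: m_closed inv_closed act_closed)

lemma commutatorI: "d \<in> D \<Longrightarrow> t \<in> T \<Longrightarrow> act d t \<otimes> inv t \<in> commutator T D"
  unfolding commutator_def by (rule generate.incl) blast

lemma commutator_subgroup:
  "T \<subseteq> carrier G \<Longrightarrow> D \<subseteq> carrier A \<Longrightarrow> subgroup (commutator T D) G"
  unfolding commutator_def by (rule generate_is_subgroup[OF commutator_generators_closed])

lemma commutator_least:
  assumes "subgroup H G" "\<And>d t. d \<in> D \<Longrightarrow> t \<in> T \<Longrightarrow> act d t \<otimes> inv t \<in> H"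
  shows "commutator T D \<subseteq> H"
  unfolding commutator_def using assms by (intro generate_subgroup_incl) auto

lemma commutator_mono: "S \<subseteq> T \<Longrightarrow> D \<subseteq> E \<Longrightarrow> commutator S D \<subseteq> commutator T E"
  unfolding commutator_def by (rule mono_generate) blast

lemma commutator_subset:
  assumes "subgroup T G" "invariant D T"
  shows "commutator T D \<subseteq> T"
proof (rule commutator_least[OF assms(1)])
  fix d t assume "d \<in> D" "t \<in> T"
  then show "act d t \<otimes> inv t \<in> T"
    using invariantD[OF assms(2)] subgroup.m_closed[OF assms(1)] subgroup.m_inv_closed[OF assms(1)]
    by simp
qed

text \<open>
  The identity \<open>[ut, d] = [u, d] \<cdot> [t, d]\<^sup>u\<close>, with \<open>[t, d] = d(t) t\<^sup>-\<^sup>1\<close>, expresses the conjugate of a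
  generator by \<open>u \<in> T\<close> through two other generators.
\<close>

lemma commutator_normalized:
  assumes T: "subgroup T G" and D: "D \<subseteq> carrier A"
  shows "normalizes T (commutator T D)"
  unfolding commutator_def
proof (rule generate_normalizes)
  show "{act d t \<otimes> inv t |d t. d \<in> D \<and> t \<in> T} \<subseteq> carrier G"
    using commutator_generators_closed[OF subgroup.subset[OF T] D] .
  show "T \<subseteq> carrier G" by (rule subgroup.subset[OF T])
  fix u k assume u: "u \<in> T" and "k \<in> {act d t \<otimes> inv t |d t. d \<in> D \<and> t \<in> T}"
  then obtain d t where k: "k = act d t \<otimes> inv t" "d \<in> D" "t \<in> T" by blast
  have c: "u \<in> carrier G" "t \<in> carrier G" "d \<in> carrier A"
    using u k D subgroup.subset[OF T] by auto
  have "u \<otimes> k \<otimes> inv u = inv (act d u \<otimes> inv u) \<otimes> (act d (u \<otimes> t) \<otimes> inv (u \<otimes> t))"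
    using c by (simp add: k(1) group_word)
  moreover have "act d u \<otimes> inv u \<in> commutator T D" "act d (u \<otimes> t) \<otimes> inv (u \<otimes> t) \<in> commutator T D"
    using commutatorI[OF k(2)] u k(3) subgroup.m_closed[OF T] by auto
  ultimately have "u \<otimes> k \<otimes> inv u \<in> commutator T D"
    using commutator_subgroup[OF subgroup.subset[OF T] D]
    by (simp add: subgroup.m_closed subgroup.m_inv_closed)
  then show "u \<otimes> k \<otimes> inv u \<in> generate G {act d t \<otimes> inv t |d t. d \<in> D \<and> t \<in> T}"
    by (simp add: commutator_def)
qed

text \<open>
  An operator \<open>e\<close> sends \<open>[t, d]\<close> to \<open>[e(t), e d e\<^sup>-\<^sup>1]\<close>, so commutators with a normal subgroup of
  operators inherit the full invariance. Applied to the semidirect product, this turns normality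
  of operator groups into normality of subgroups of \<open>G\<close>.
\<close>

lemma commutator_invariant:
  assumes T: "T \<subseteq> carrier G" and D: "D \<subseteq> carrier A" and E: "E \<subseteq> carrier A"
    and inv: "invariant E T" and norm: "A.normalizes E D"
  shows "invariant E (commutator T D)"
  unfolding commutator_def
proof (rule invariant_generate[OF commutator_generators_closed[OF T D] E])
  fix e k assume e: "e \<in> E" and "k \<in> {act d t \<otimes> inv t |d t. d \<in> D \<and> t \<in> T}"
  then obtain d t where k: "k = act d t \<otimes> inv t" "d \<in> D" "t \<in> T" by blast
  have c: "e \<in> carrier A" "t \<in> carrier G" "d \<in> carrier A"
    using e k D T E by auto
  let ?d = "e \<otimes>\<^bsub>A\<^esub> d \<otimes>\<^bsub>A\<^esub> inv\<^bsub>A\<^esub> e"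
  have "act e k = act ?d (act e t) \<otimes> inv (act e t)"
    using c by (simp add: k(1) act_compose)
  moreover have "?d \<in> D" using A.normalizesD[OF norm e k(2)] .
  moreover have "act e t \<in> T" using invariantD[OF inv e k(3)] .
  ultimately show "act e k \<in> generate G {act d t \<otimes> inv t |d t. d \<in> D \<and> t \<in> T}"
    by (blast intro: generate.incl)
qed

primrec commutator_series :: "'a set \<Rightarrow> 'b set \<Rightarrow> nat \<Rightarrow> 'a set" where
  "commutator_series T D 0 = T"
| "commutator_series T D (Suc n) = commutator (commutator_series T D n) D"

lemma commutator_series_mono:
  "S \<subseteq> T \<Longrightarrow> D \<subseteq> E \<Longrightarrow> commutator_series S D n \<subseteq> commutator_series T E n"
  by (induction n) (simp_all add: commutator_mono)

lemma commutator_series_subgroup: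
  assumes "subgroup T G" "D \<subseteq> carrier A"
  shows "subgroup (commutator_series T D n) G"
  using assms by (induction n) (auto intro: commutator_subgroup dest: subgroup.subset)

lemma commutator_series_invariant:
  assumes T: "subgroup T G" and D: "D \<subseteq> carrier A" and E: "E \<subseteq> carrier A"
    and inv: "invariant E T" and norm: "A.normalizes E D"
  shows "invariant E (commutator_series T D n)"
proof (induction n)
  case 0
  then show ?case using inv by simp
next
  case (Suc n)
  then show ?case
    using commutator_invariant[OF subgroup.subset[OF commutator_series_subgroup[OF T D]] D E _ norm]
    by simp
qed

lemma commutator_series_decreasing:
  assumes "subgroup T G" "subgroup D A" "invariant D T"
  shows "commutator_series T D (Suc n) \<subseteq> commutator_series T D n"
  using subgroup.subset[OF assms(2)] commutator_series_subgroup[OF assms(1)]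
    commutator_series_invariant[OF assms(1) _ _ assms(3) A.subgroup_normalizes_self[OF assms(2)]]
  by (simp add: commutator_subset)

lemma commutator_series_stable:
  assumes "subgroup T G" "subgroup D A" "invariant D T" "finite T"
  obtains n where "\<And>m. n \<le> m \<Longrightarrow> commutator_series T D m = commutator_series T D n"
  using decreasing_sets_stabilize[of "commutator_series T D"] commutator_series_decreasing[OF assms(1-3)] assms(4)
  by (metis commutator_series.simps(1))

lemma act_mult_commutator:
  assumes "d \<in> carrier A" "u \<in> carrier G" "y \<in> carrier G"
  shows "act d (u \<otimes> y) \<otimes> inv (u \<otimes> y)
    = (act d u \<otimes> inv u) \<otimes> (u \<otimes> (act d y \<otimes> inv y) \<otimes> inv u)"
  using assms by (simp add: group_word)

text \<open>
  Computing modulo \<open>Y\<close> without forming a quotient: if \<open>t\<close> agrees with an element of \<open>U\<close> modulo \<open>Y\<close>,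
  then so does its commutator with one of \<open>[U, D]\<close>. All descents along a series use this rule.
\<close>
lemma commutator_of_product:
  assumes d: "d \<in> D" "D \<subseteq> carrier A" and U: "subgroup U G" and Y: "subgroup Y G"
    and norm: "normalizes U Y" and inv: "invariant D Y" and t: "t \<in> U <#> Y"
  shows "act d t \<otimes> inv t \<in> commutator U D <#> Y"
proof -
  obtain u y where u: "u \<in> U" "y \<in> Y" "t = u \<otimes> y" using t by (elim set_mult_memE)
  have c: "d \<in> carrier A" "u \<in> carrier G" "y \<in> carrier G"
    using d u subgroup.subset[OF U] subgroup.subset[OF Y] by auto
  have "act d y \<otimes> inv y \<in> Y"
    using invariantD[OF inv d(1) u(2)] u Y by (simp add: subgroup.m_closed subgroup.m_inv_closed)
  then show ?thesis
    using act_mult_commutator[OF c] u(3) commutatorI[OF d(1) u(1)] normalizesD[OF norm u(1)]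
    by (simp add: set_mult_memI)
qed

end

section \<open>Operators acting nilpotently modulo a subgroup\<close>

context operator_group begin

text \<open>
  By the identities \<open>[t, ab] = [b(t), a] \<cdot> [t, b]\<close> and \<open>[t, h\<^sup>-\<^sup>1] = [h\<^sup>-\<^sup>1(t), h]\<^sup>-\<^sup>1\<close>, commutators with
  generators of the operator group suffice.
\<close>

lemma commutator_generate_least:
  assumes T: "T \<subseteq> carrier G" and H: "H \<subseteq> carrier A"
    and inv: "invariant (generate A H) T" and Y: "subgroup Y G"
    and gen: "\<And>h t. h \<in> H \<Longrightarrow> t \<in> T \<Longrightarrow> act h t \<otimes> inv t \<in> Y"
  shows "commutator T (generate A H) \<subseteq> Y"
proof (rule commutator_least[OF Y])
  fix d t assume "d \<in> generate A H" "t \<in> T"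
  then show "act d t \<otimes> inv t \<in> Y"
  proof (induction arbitrary: t rule: generate.induct)
    case one
    then show ?case using T subgroup.one_closed[OF Y] by (auto simp: act_one)
  next
    case (incl h)
    then show ?case by (rule gen)
  next
    case (inv h)
    let ?s = "act (inv\<^bsub>A\<^esub> h) t"
    have c: "h \<in> carrier A" "t \<in> carrier G" using inv H T by auto
    have "?s \<in> T"
      using invariantD[OF assms(3) generate.inv[OF inv(1)]] inv(2) .
    from gen[OF inv(1) this] have "t \<otimes> inv ?s \<in> Y" using c by simp
    from subgroup.m_inv_closed[OF Y this] show ?case using c by (simp add: group_word)
  next
    case (eng a b)
    have c: "a \<in> carrier A" "b \<in> carrier A" "t \<in> carrier G"
      using eng A.generate_in_carrier[OF H] T by auto
    have "act b t \<in> T" using invariantD[OF inv eng(2) eng(5)] .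
    from subgroup.m_closed[OF Y eng.IH(1)[OF this] eng.IH(2)[OF eng.prems]]
    have "(act a (act b t) \<otimes> inv (act b t)) \<otimes> (act b t \<otimes> inv t) \<in> Y" .
    then show ?case using c by (simp add: act_compose group_word)
  qed
qed

text \<open>
  For \<open>L\<close> normal and invariant this says that \<open>D\<close> stabilises a finite chain of subgroups of \<open>G/L\<close>.
\<close>

definition nil_mod :: "'a set \<Rightarrow> 'b set \<Rightarrow> bool" where
  "nil_mod L D \<longleftrightarrow> (\<exists>n. commutator_series (carrier G) D n \<subseteq> L)"

lemma nil_mod_subset: "nil_mod L E \<Longrightarrow> D \<subseteq> E \<Longrightarrow> nil_mod L D"
  unfolding nil_mod_def using commutator_series_mono[of "carrier G" "carrier G" D E] by blast

definition nil_normal :: "'a set \<Rightarrow> 'b set \<Rightarrow> 'b set \<Rightarrow> bool" where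
  "nil_normal L E K \<longleftrightarrow> subgroup K A \<and> K \<subseteq> E \<and> A.normalizes E K \<and> nil_mod L K"

text \<open>
  Fitting's theorem for operators. Let \<open>T = [T, D]\<close> be the final term of the series of the group
  \<open>D\<close> generated by the given subgroups, and suppose \<open>T\<close> is not contained in \<open>L\<close>. Choose a maximal
  proper subgroup \<open>Y\<close> among the invariant normal subgroups of \<open>T\<close> containing \<open>T \<inter> L\<close>. If some \<open>K\<close>
  had \<open>[T, K]\<close> not in \<open>Y\<close>, then \<open>T = [T, K] Y\<close> by maximality, and repeated substitution
  of this equation into itself puts \<open>T\<close> into \<open>(T \<inter> L) Y = Y\<close>, as \<open>K\<close> acts nilpotently. So every
  \<open>K\<close> acts trivially modulo \<open>Y\<close>, hence so does \<open>D\<close>, against \<open>T = [T, D]\<close>.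
\<close>

lemma nil_mod_generate:
  assumes fin: "finite (carrier G)" and L: "L \<lhd> G"
    and E: "subgroup E A" "invariant E L"
    and nn: "\<And>K. K \<in> F \<Longrightarrow> nil_normal L E K"
  shows "nil_mod L (generate A (\<Union>F))"
proof -
  define D where "D = generate A (\<Union>F)"
  have EA: "E \<subseteq> carrier A" by (rule subgroup.subset[OF E(1)])
  have FE: "\<Union>F \<subseteq> E" using nn by (auto simp: nil_normal_def)
  have D: "subgroup D A" unfolding D_def using FE EA by (intro A.generate_is_subgroup) auto
  have DE: "D \<subseteq> E" unfolding D_def using FE E(1) by (rule A.generate_subgroup_incl)
  have DA: "D \<subseteq> carrier A" using DE EA by blast
  have Lsub: "subgroup L G" and Lnorm: "normalizes (carrier G) L"
    using L by (simp_all add: normal_iff_normalizes)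
  obtain n where n: "\<And>m. n \<le> m \<Longrightarrow> commutator_series (carrier G) D m = commutator_series (carrier G) D n"
    using commutator_series_stable[OF subgroup_self D invariant_carrier[OF DA] fin] by blast
  define T where "T = commutator_series (carrier G) D n"
  have T: "subgroup T G" unfolding T_def by (rule commutator_series_subgroup[OF subgroup_self DA])
  have TG: "T \<subseteq> carrier G" by (rule subgroup.subset[OF T])
  have Tinv: "invariant D T"
    unfolding T_def
    by (rule commutator_series_invariant[OF subgroup_self DA DA invariant_carrier[OF DA]
          A.subgroup_normalizes_self[OF D]])
  have TD: "commutator T D = T" using n[of "Suc n"] by (simp add: T_def)
  have "T \<subseteq> L"
  proof (rule ccontr)
    assume notL: "\<not> T \<subseteq> L"
    \<comment> \<open>The candidates for \<open>Y\<close>; the smallest of them, \<open>T \<inter> L\<close>, is proper by assumption.\<close>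
    define P where "P = (\<lambda>Y. subgroup Y G \<and> Y \<subset> T \<and> normalizes T Y \<and> invariant D Y \<and> T \<inter> L \<subseteq> Y)"
    have "P (T \<inter> L)"
      unfolding P_def
    proof (intro conjI)
      show "normalizes T (T \<inter> L)"
        using normalizes_subset[OF Lnorm TG] subgroup_normalizes_self[OF T]
        by (simp add: normalizes_def)
      show "invariant D (T \<inter> L)"
        by (rule invariant_Int[OF Tinv invariant_subset[OF E(2) DE]])
      show "subgroup (T \<inter> L) G" by (rule subgroups_Inter_pair[OF T Lsub])
      show "T \<inter> L \<subset> T" using notL by blast
    qed simp
    moreover have "finite {Y. P Y}"
      by (rule finite_subset[of _ "Pow (carrier G)"]) (use fin TG in \<open>auto simp: P_def\<close>)
    ultimately obtain Y where PY: "P Y" and max: "\<And>Z. P Z \<Longrightarrow> Y \<subseteq> Z \<Longrightarrow> Z = Y"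
      using finite_has_maximal[of "{Y. P Y}"] by blast
    have Y: "subgroup Y G" "Y \<subset> T" "normalizes T Y" "invariant D Y" "T \<inter> L \<subseteq> Y"
      using PY by (auto simp: P_def)
    have YG: "Y \<subseteq> carrier G" by (rule subgroup.subset[OF Y(1)])
    have "commutator T K \<subseteq> Y" if KF: "K \<in> F" for K
    proof (rule ccontr)
      assume notY: "\<not> commutator T K \<subseteq> Y"
      have K: "subgroup K A" "K \<subseteq> E" "A.normalizes E K" "nil_mod L K"
        using nn[OF KF] by (auto simp: nil_normal_def)
      have KD: "K \<subseteq> D" unfolding D_def using KF by (auto intro: generate.incl)
      have KA: "K \<subseteq> carrier A" by (rule subgroup.subset[OF K(1)])
      define C where "C = commutator T K"
      have C: "subgroup C G" unfolding C_def by (rule commutator_subgroup[OF TG KA])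
      have CT: "C \<subseteq> T" unfolding C_def by (rule commutator_subset[OF T invariant_subset[OF Tinv KD]])
      have CG: "C \<subseteq> carrier G" using CT TG by blast
      have Cinv: "invariant D C" unfolding C_def
        by (rule commutator_invariant[OF TG KA DA Tinv A.normalizes_subset[OF K(3) DE]])
      have Z: "subgroup (C <#> Y) G"
        by (rule subgroup_mult_normalized[OF C Y(1) normalizes_subset[OF Y(3) CT]])
      have ZT: "C <#> Y = T"
      proof (rule ccontr)
        assume "C <#> Y \<noteq> T"
        moreover have "C <#> Y \<subseteq> T" using set_mult_least[OF T CT] Y(2) by blast
        moreover have "normalizes T (C <#> Y)"
          by (rule normalizes_set_mult[OF _ Y(3) TG CG YG])
            (simp add: C_def commutator_normalized[OF T KA])
        moreover have "invariant D (C <#> Y)"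
          by (rule invariant_set_mult[OF Cinv Y(4) DA CG YG])
        ultimately have "P (C <#> Y)"
          unfolding P_def using Z Y(5) set_mult_incl[OF C Y(1)] by blast
        from max[OF this] have "C <#> Y = Y" using set_mult_incl[OF C Y(1)] by blast
        then show False using notY set_mult_incl[OF C Y(1)] by (simp add: C_def)
      qed
      define S where "S = commutator_series (carrier G) K"
      have S: "subgroup (S j) G" for j
        unfolding S_def by (rule commutator_series_subgroup[OF subgroup_self KA])
      have ST: "subgroup (S j \<inter> T) G" for j using S T by (rule subgroups_Inter_pair)
      \<comment> \<open>Substituting \<open>T = [T, K] Y\<close> into itself \<open>j\<close> times.\<close>
      have "T \<subseteq> (S j \<inter> T) <#> Y" for j
      proof (induction j)
        case 0
        have "S 0 \<inter> T = T" using TG by (auto simp: S_def)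
        then show ?case using set_mult_incl[OF T Y(1)] by simp
      next
        case (Suc j)
        let ?W = "(S (Suc j) \<inter> T) <#> Y"
        have W: "subgroup ?W G"
          by (rule subgroup_mult_normalized[OF ST Y(1) normalizes_subset[OF Y(3)]]) blast
        have sub: "commutator (S j \<inter> T) K \<subseteq> S (Suc j) \<inter> T"
          using commutator_mono[of "S j \<inter> T" "S j" K K] commutator_mono[of "S j \<inter> T" T K K] CT
          by (auto simp: S_def C_def)
        have "C \<subseteq> ?W"
          unfolding C_def
        proof (rule commutator_least[OF W])
          fix k t assume "k \<in> K" "t \<in> T"
          then have "act k t \<otimes> inv t \<in> commutator (S j \<inter> T) K <#> Y"
            using Suc by (intro commutator_of_product[OF _ KA ST Y(1) normalizes_subset[OF Y(3)]
                  invariant_subset[OF Y(4) KD]]) auto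
          then show "act k t \<otimes> inv t \<in> ?W" using mono_set_mult[OF sub subset_refl] by blast
        qed
        then have "C <#> Y \<subseteq> ?W"
          using set_mult_incl(2)[OF ST Y(1)] by (intro set_mult_least[OF W]) auto
        then show ?case by (simp add: ZT)
      qed
      moreover obtain j where "S j \<subseteq> L" using K(4) by (auto simp: nil_mod_def S_def)
      then have "(S j \<inter> T) <#> Y \<subseteq> Y" using Y(5) by (intro set_mult_least[OF Y(1)]) auto
      ultimately show False using Y(2) by blast
    qed
    then have "commutator T D \<subseteq> Y"
      unfolding D_def using FE EA Tinv
      by (intro commutator_generate_least[OF TG _ _ Y(1)]) (auto simp: D_def commutatorI subset_iff)
    then show False using TD Y(2) by blast
  qed
  then show ?thesis unfolding nil_mod_def T_def D_def by blast
qed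

definition nil_radical :: "'a set \<Rightarrow> 'b set \<Rightarrow> 'b set" where
  "nil_radical L E = generate A (\<Union>{K. nil_normal L E K})"

text \<open>
  The series of a conjugate of \<open>K\<close> by \<open>f\<close> is the image under \<open>f\<close> of the series of \<open>K\<close>.
\<close>

lemma nil_mod_conjugate:
  assumes K: "K \<subseteq> carrier A" and f: "f \<in> carrier A" and L: "invariant {f} L"
    and nil: "nil_mod L K"
  shows "nil_mod L ((\<lambda>k. f \<otimes>\<^bsub>A\<^esub> k \<otimes>\<^bsub>A\<^esub> inv\<^bsub>A\<^esub> f) ` K)" (is "nil_mod L ?K")
proof -
  interpret h: group_hom G G "act f"
    using act_hom[OF f] by unfold_locales
  define S where "S = commutator_series (carrier G) K"
  have S: "subgroup (S n) G" for n
    unfolding S_def by (rule commutator_series_subgroup[OF subgroup_self K])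
  have "commutator_series (carrier G) ?K n \<subseteq> act f ` S n" for n
  proof (induction n)
    case 0
    have "x \<in> act f ` carrier G" if "x \<in> carrier G" for x
      using act_cancel(2)[OF f that] act_closed[OF A.inv_closed[OF f] that] by (metis imageI)
    then show ?case by (auto simp: S_def)
  next
    case (Suc n)
    have "commutator (act f ` S n) ?K \<subseteq> act f ` S (Suc n)"
    proof (rule commutator_least[OF h.subgroup_img_is_subgroup[OF S]])
      fix d t assume "d \<in> ?K" "t \<in> act f ` S n"
      then obtain k s where ks: "k \<in> K" "d = f \<otimes>\<^bsub>A\<^esub> k \<otimes>\<^bsub>A\<^esub> inv\<^bsub>A\<^esub> f" "s \<in> S n" "t = act f s"
        by blast
      have c: "k \<in> carrier A" "s \<in> carrier G" using ks K subgroup.subset[OF S] by auto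
      have "act d t \<otimes> inv t = act f (act k s \<otimes> inv s)"
        using c f by (simp add: ks act_compose)
      moreover have "act k s \<otimes> inv s \<in> S (Suc n)"
        using commutatorI[OF ks(1,3)] by (simp add: S_def)
      ultimately show "act d t \<otimes> inv t \<in> act f ` S (Suc n)" by simp
    qed
    moreover have "commutator (commutator_series (carrier G) ?K n) ?K \<subseteq> commutator (act f ` S n) ?K"
      by (rule commutator_mono[OF Suc subset_refl])
    ultimately show ?case by simp
  qed
  moreover obtain n where "S n \<subseteq> L" using nil by (auto simp: nil_mod_def S_def)
  then have "act f ` S n \<subseteq> L" using L by (auto simp: invariant_def)
  ultimately show ?thesis unfolding nil_mod_def by blast
qed

lemma nil_radical_subset:
  assumes "subgroup E A" shows "nil_radical L E \<subseteq> E"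
  unfolding nil_radical_def
  by (rule A.generate_subgroup_incl[OF _ assms]) (auto simp: nil_normal_def)

lemma nil_radical_subgroup:
  assumes "subgroup E A" shows "subgroup (nil_radical L E) A"
  unfolding nil_radical_def using subgroup.subset[OF assms]
  by (intro A.generate_is_subgroup) (force simp: nil_normal_def)

lemma nil_radical_upper: "nil_normal L E K \<Longrightarrow> K \<subseteq> nil_radical L E"
  unfolding nil_radical_def by (auto intro: generate.incl)

text \<open>
  Conjugation by an element that normalises \<open>E\<close> permutes the subgroups generating the radical.
\<close>

lemma nil_radical_normalized:
  assumes E: "subgroup E A" and F: "subgroup F A" and norm: "A.normalizes F E"
    and L: "invariant F L"
  shows "A.normalizes F (nil_radical L E)"
  unfolding nil_radical_def
proof (rule A.generate_normalizes)
  show "\<Union>{K. nil_normal L E K} \<subseteq> carrier A"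
    using subgroup.subset[OF E] by (auto simp: nil_normal_def)
  show FA: "F \<subseteq> carrier A" by (rule subgroup.subset[OF F])
  fix f k assume f: "f \<in> F" and "k \<in> \<Union>{K. nil_normal L E K}"
  then obtain K where k: "k \<in> K" and nK: "nil_normal L E K" by blast
  have K: "subgroup K A" "K \<subseteq> E" "A.normalizes E K" "nil_mod L K"
    using nK by (auto simp: nil_normal_def)
  have fA: "f \<in> carrier A" using f FA by blast
  let ?c = "\<lambda>k. f \<otimes>\<^bsub>A\<^esub> k \<otimes>\<^bsub>A\<^esub> inv\<^bsub>A\<^esub> f"
  interpret h: group_hom A A ?c
    using A.conjugation_hom[OF fA] by unfold_locales
  have "nil_normal L E (?c ` K)"
    unfolding nil_normal_def
  proof (intro conjI)
    show "subgroup (?c ` K) A" by (rule h.subgroup_img_is_subgroup[OF K(1)])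
    show "?c ` K \<subseteq> E" using A.normalizesD[OF norm f] K(2) by blast
    show "nil_mod L (?c ` K)"
      using nil_mod_conjugate[OF subgroup.subset[OF K(1)] fA _ K(4)] invariant_subset[OF L] f by simp
    show "A.normalizes E (?c ` K)"
      unfolding A.normalizes_def
    proof (intro ballI)
      fix e x assume e: "e \<in> E" and "x \<in> ?c ` K"
      then obtain y where y: "y \<in> K" "x = ?c y" by blast
      let ?e = "inv\<^bsub>A\<^esub> f \<otimes>\<^bsub>A\<^esub> e \<otimes>\<^bsub>A\<^esub> inv\<^bsub>A\<^esub> (inv\<^bsub>A\<^esub> f)"
      have "?e \<in> E" using A.normalizesD[OF norm subgroup.m_inv_closed[OF F f] e] .
      then have "?e \<otimes>\<^bsub>A\<^esub> y \<otimes>\<^bsub>A\<^esub> inv\<^bsub>A\<^esub> ?e \<in> K" by (rule A.normalizesD[OF K(3) _ y(1)])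
      moreover have "e \<otimes>\<^bsub>A\<^esub> x \<otimes>\<^bsub>A\<^esub> inv\<^bsub>A\<^esub> e = ?c (?e \<otimes>\<^bsub>A\<^esub> y \<otimes>\<^bsub>A\<^esub> inv\<^bsub>A\<^esub> ?e)"
        using fA subgroup.mem_carrier[OF E e] subgroup.mem_carrier[OF K(1) y(1)]
        by (simp add: y(2) A.group_word)
      ultimately show "e \<otimes>\<^bsub>A\<^esub> x \<otimes>\<^bsub>A\<^esub> inv\<^bsub>A\<^esub> e \<in> ?c ` K" by blast
    qed
  qed
  then have "?c k \<in> nil_radical L E" using nil_radical_upper k by blast
  then show "?c k \<in> generate A (\<Union>{K. nil_normal L E K})" by (simp add: nil_radical_def)
qed

lemma nil_mod_nil_radical:
  assumes "finite (carrier G)" "L \<lhd> G" "subgroup E A" "invariant E L"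
  shows "nil_mod L (nil_radical L E)"
  unfolding nil_radical_def by (rule nil_mod_generate[OF assms]) simp

text \<open>
  The radical of \<open>E\<close> is normal in \<open>F\<close> and acts nilpotently, so it is itself one of the subgroups
  generating the radical of \<open>F\<close>. Along a subnormal chain this carries a nilpotently
  acting subgroup into the radical of the whole group.
\<close>

lemma nil_radical_mono:
  assumes "finite (carrier G)" "L \<lhd> G" and E: "subgroup E A" and F: "subgroup F A"
    and sub: "E \<subseteq> F" and norm: "A.normalizes F E" and L: "invariant F L"
  shows "nil_radical L E \<subseteq> nil_radical L F"
  using nil_radical_subset[OF E] nil_radical_subgroup[OF E] nil_radical_normalized[OF E F norm L]
    nil_mod_nil_radical[OF assms(1-2) E invariant_subset[OF L sub]] sub
  by (intro nil_radical_upper) (auto simp: nil_normal_def)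

end

section \<open>Lower central series and the nilpotent residual\<close>

context group begin

text \<open>
  Products, inverses and generated subgroups agree in a subgroup and in the ambient group. With
  the series rewritten in ambient terms, it can be compared with subgroups not contained in \<open>N\<close>.
\<close>

lemma lower_central_Suc_subgroup:
  assumes N: "subgroup N G" and sub: "lower_central (G\<lparr>carrier := N\<rparr>) i \<subseteq> N"
  shows "lower_central (G\<lparr>carrier := N\<rparr>) (Suc i) = generate G
    {x \<otimes> y \<otimes> inv x \<otimes> inv y | x y. x \<in> lower_central (G\<lparr>carrier := N\<rparr>) i \<and> y \<in> N}" (is "_ = generate G ?K")
proof -
  have eq: "{x \<otimes>\<^bsub>G\<lparr>carrier := N\<rparr>\<^esub> y \<otimes>\<^bsub>G\<lparr>carrier := N\<rparr>\<^esub> inv\<^bsub>G\<lparr>carrier := N\<rparr>\<^esub> x \<otimes>\<^bsub>G\<lparr>carrier := N\<rparr>\<^esub> inv\<^bsub>G\<lparr>carrier := N\<rparr>\<^esub> y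
      | x y. x \<in> lower_central (G\<lparr>carrier := N\<rparr>) i \<and> y \<in> carrier (G\<lparr>carrier := N\<rparr>)} = ?K"
    using sub m_inv_consistent[OF N] by (auto simp: subset_iff) metis+
  have "?K \<subseteq> N"
    using sub subgroup.m_closed[OF N] subgroup.m_inv_closed[OF N] by (auto simp: subset_iff)
  then show ?thesis
    unfolding lower_central.simps(2) eq by (rule generate_consistent[OF _ N])
qed

lemma lower_central_subgroup:
  assumes N: "subgroup N G"
  shows "subgroup (lower_central (G\<lparr>carrier := N\<rparr>) i) G \<and> lower_central (G\<lparr>carrier := N\<rparr>) i \<subseteq> N"
proof (induction i)
  case 0
  then show ?case using N by simp
next
  case (Suc i)
  let ?K = "{x \<otimes> y \<otimes> inv x \<otimes> inv y | x y. x \<in> lower_central (G\<lparr>carrier := N\<rparr>) i \<and> y \<in> N}"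
  have "?K \<subseteq> N"
    using Suc subgroup.m_closed[OF N] subgroup.m_inv_closed[OF N] by (auto simp: subset_iff)
  then show ?case
    unfolding lower_central_Suc_subgroup[OF N conjunct2[OF Suc]]
    using generate_is_subgroup[of ?K] generate_subgroup_incl[OF _ N, of ?K] subgroup.subset[OF N]
    by blast
qed

lemma lower_central_commutator:
  assumes N: "subgroup N G" and "x \<in> lower_central (G\<lparr>carrier := N\<rparr>) i" "y \<in> N"
  shows "x \<otimes> y \<otimes> inv x \<otimes> inv y \<in> lower_central (G\<lparr>carrier := N\<rparr>) (Suc i)"
  unfolding lower_central_Suc_subgroup[OF N conjunct2[OF lower_central_subgroup[OF N]]]
  using assms(2,3) by (blast intro: generate.incl)

lemma lower_central_normalized:
  assumes N: "subgroup N G" and U: "U \<subseteq> carrier G" "normalizes U N"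
  shows "normalizes U (lower_central (G\<lparr>carrier := N\<rparr>) i)"
proof (induction i)
  case 0
  then show ?case using U by simp
next
  case (Suc i)
  note low = lower_central_subgroup[OF N, of i]
  have NG: "N \<subseteq> carrier G" by (rule subgroup.subset[OF N])
  show ?case
    unfolding lower_central_Suc_subgroup[OF N conjunct2[OF low]]
  proof (rule generate_normalizes[OF _ U(1)])
    show "{x \<otimes> y \<otimes> inv x \<otimes> inv y |x y. x \<in> lower_central (G\<lparr>carrier := N\<rparr>) i \<and> y \<in> N} \<subseteq> carrier G"
      using low NG by (auto intro!: m_closed inv_closed)
    fix u k assume u: "u \<in> U"
      and "k \<in> {x \<otimes> y \<otimes> inv x \<otimes> inv y |x y. x \<in> lower_central (G\<lparr>carrier := N\<rparr>) i \<and> y \<in> N}"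
    then obtain x y where k: "k = x \<otimes> y \<otimes> inv x \<otimes> inv y" "x \<in> lower_central (G\<lparr>carrier := N\<rparr>) i" "y \<in> N"
      by blast
    have c: "u \<in> carrier G" "x \<in> carrier G" "y \<in> carrier G" using u k low NG U by auto
    let ?x = "u \<otimes> x \<otimes> inv u" and ?y = "u \<otimes> y \<otimes> inv u"
    have "u \<otimes> k \<otimes> inv u = ?x \<otimes> ?y \<otimes> inv ?x \<otimes> inv ?y"
      using c by (simp add: k(1) group_word)
    then show "u \<otimes> k \<otimes> inv u \<in> generate G
        {x \<otimes> y \<otimes> inv x \<otimes> inv y |x y. x \<in> lower_central (G\<lparr>carrier := N\<rparr>) i \<and> y \<in> N}"
      using normalizesD[OF Suc u k(2)] normalizesD[OF U(2) u k(3)] by (blast intro: generate.incl)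
  qed
qed

lemma lower_central_subset: "lower_central G n \<subseteq> carrier G"
  using lower_central_subgroup[OF subgroup_self, of n] by simp

lemma lower_central_normal: "lower_central G n \<lhd> G"
  unfolding normal_iff_normalizes
  using lower_central_subgroup[OF subgroup_self, of n]
    lower_central_normalized[OF subgroup_self subset_refl subgroup_normalizes_self[OF subgroup_self], of n]
  by simp

lemma lower_central_decreasing: "lower_central G (Suc n) \<subseteq> lower_central G n"
proof -
  have sub: "subgroup (lower_central G n) G" and norm: "normalizes (carrier G) (lower_central G n)"
    using lower_central_normal by (simp_all add: normal_iff_normalizes)
  show ?thesis
    unfolding lower_central.simps(2)
  proof (rule generate_subgroup_incl[OF _ sub], clarify)
    fix x y assume x: "x \<in> lower_central G n" and y: "y \<in> carrier G"
    have c: "x \<in> carrier G" using x sub subgroup.subset by blast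
    have "x \<otimes> y \<otimes> inv x \<otimes> inv y = x \<otimes> (y \<otimes> inv x \<otimes> inv y)" using c y by (simp add: m_assoc)
    then show "x \<otimes> y \<otimes> inv x \<otimes> inv y \<in> lower_central G n"
      using subgroup.m_closed[OF sub x normalizesD[OF norm y subgroup.m_inv_closed[OF sub x]]] by simp
  qed
qed

end

lemma (in group_hom) lower_central_image:
  assumes surj: "h ` carrier G = carrier H"
  shows "lower_central H n = h ` lower_central G n"
proof (induction n)
  case 0
  then show ?case using surj by simp
next
  case (Suc n)
  have eq: "{x \<otimes>\<^bsub>H\<^esub> y \<otimes>\<^bsub>H\<^esub> inv\<^bsub>H\<^esub> x \<otimes>\<^bsub>H\<^esub> inv\<^bsub>H\<^esub> y | x y. x \<in> h ` lower_central G n \<and> y \<in> carrier H}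
      = h ` {x \<otimes> y \<otimes> inv x \<otimes> inv y | x y. x \<in> lower_central G n \<and> y \<in> carrier G}" (is "?L = h ` ?R")
  proof -
    have e: "h (x \<otimes> y \<otimes> inv x \<otimes> inv y) = h x \<otimes>\<^bsub>H\<^esub> h y \<otimes>\<^bsub>H\<^esub> inv\<^bsub>H\<^esub> h x \<otimes>\<^bsub>H\<^esub> inv\<^bsub>H\<^esub> h y"
      if "x \<in> lower_central G n" "y \<in> carrier G" for x y
      using that G.lower_central_subset by (auto simp: subset_iff)
    show ?thesis
    proof
      show "?L \<subseteq> h ` ?R"
        unfolding surj[symmetric] using e by (auto simp: image_iff) metis
      show "h ` ?R \<subseteq> ?L"
        unfolding surj[symmetric] using e by auto
    qed
  qed
  have "{x \<otimes> y \<otimes> inv x \<otimes> inv y | x y. x \<in> lower_central G n \<and> y \<in> carrier G} \<subseteq> carrier G"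
    using G.lower_central_subset by (auto intro!: G.m_closed G.inv_closed)
  from generate_img[OF this] show ?case
    unfolding lower_central.simps(2) Suc eq by simp
qed

context group begin

lemma nilpotent_quotient_iff:
  assumes N: "N \<lhd> G"
  shows "nilpotent_group (G Mod N) \<longleftrightarrow> (\<exists>n. lower_central G n \<subseteq> N)"
proof -
  interpret N: normal N G by (rule N)
  interpret h: group_hom G "G Mod N" "\<lambda>x. N #> x"
    by (rule group_hom.intro[OF is_group N.factorgroup_is_group])
      (simp add: group_hom_axioms_def N.r_coset_hom_Mod)
  have "lower_central (G Mod N) n = {\<one>\<^bsub>G Mod N\<^esub>} \<longleftrightarrow> lower_central G n \<subseteq> N" for n
  proof -
    have "lower_central (G Mod N) n = (\<lambda>x. N #> x) ` lower_central G n"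
      by (rule h.lower_central_image) (simp add: carrier_FactGroup)
    moreover have "lower_central G n \<noteq> {}"
      using lower_central_normal[of n] normal_imp_subgroup subgroup.one_closed by blast
    then have "(\<lambda>x. N #> x) ` lower_central G n = {N} \<longleftrightarrow> (\<forall>x\<in>lower_central G n. N #> x = N)"
      by blast
    moreover have "N #> x = N \<longleftrightarrow> x \<in> N" if "x \<in> lower_central G n" for x
      using subsetD[OF lower_central_subset that] coset_join1[of N x] coset_join2[of x N]
        N.subgroup_axioms by blast
    ultimately show ?thesis by auto
  qed
  then show ?thesis using N.factorgroup_is_group by (simp add: nilpotent_group_def)
qed

text \<open>
  The lower central series of a finite group becomes stationary, and its last term is the least
  normal subgroup with nilpotent quotient.
\<close>

lemma nilpotent_residual_subset_iff:
  assumes "finite (carrier G)"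
  shows "nilpotent_residual G \<subseteq> L \<longleftrightarrow> (\<exists>n. lower_central G n \<subseteq> L)"
proof -
  obtain n where n: "\<And>m. n \<le> m \<Longrightarrow> lower_central G m = lower_central G n"
    using decreasing_sets_stabilize[of "lower_central G", OF lower_central_decreasing] assms by auto
  have le: "lower_central G n \<subseteq> lower_central G m" for m
  proof (cases "n \<le> m")
    case True
    then show ?thesis using n[of m] by simp
  next
    case False
    then show ?thesis
      using lift_Suc_antimono_le[of "lower_central G", OF lower_central_decreasing, of m n] by simp
  qed
  have "nilpotent_residual G = lower_central G n"
    unfolding nilpotent_residual_def
  proof (rule Least_equality)
    show "lower_central G n \<lhd> G \<and> nilpotent_group (G Mod lower_central G n)"
      using lower_central_normal[of n] nilpotent_quotient_iff[OF lower_central_normal[of n]] by auto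
    fix N assume N: "N \<lhd> G \<and> nilpotent_group (G Mod N)"
    then obtain m where "lower_central G m \<subseteq> N" using nilpotent_quotient_iff[of N] by auto
    then show "lower_central G n \<subseteq> N" using le[of m] by (rule subset_trans[rotated])
  qed
  then show ?thesis using le by blast
qed

end

section \<open>The semidirect product acting by affine conjugation\<close>

context operator_group begin

definition semidirect :: "('a \<times> 'b) monoid" where
  "semidirect = \<lparr>carrier = carrier G \<times> carrier A,
    monoid.mult = (\<lambda>(x, g) (y, h). (x \<otimes> act g y, g \<otimes>\<^bsub>A\<^esub> h)), one = (\<one>, \<one>\<^bsub>A\<^esub>)\<rparr>"

text \<open>
  The holomorph action: elements of \<open>G\<close> act by conjugation, elements of \<open>A\<close> as operators, so one
  commutator series covers both \<open>[T, A]\<close> and \<open>[T, G]\<close>.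
\<close>

definition affine_act :: "'a \<times> 'b \<Rightarrow> 'a \<Rightarrow> 'a" where
  "affine_act = (\<lambda>(x, g) v. x \<otimes> act g v \<otimes> inv x)"

lemma semidirect_simps [simp]:
  "carrier semidirect = carrier G \<times> carrier A"
  "(x, g) \<otimes>\<^bsub>semidirect\<^esub> (y, h) = (x \<otimes> act g y, g \<otimes>\<^bsub>A\<^esub> h)"
  "\<one>\<^bsub>semidirect\<^esub> = (\<one>, \<one>\<^bsub>A\<^esub>)"
  "affine_act (x, g) v = x \<otimes> act g v \<otimes> inv x"
  by (simp_all add: semidirect_def affine_act_def)

lemma act_unit [simp]: "a \<in> carrier A \<Longrightarrow> act a \<one> = \<one>"
  using act_inv[of a \<one>] act_mult[of a \<one> "inv \<one>"] by simp

lemma semidirect_group: "group semidirect"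
proof (rule groupI)
  fix p assume "p \<in> carrier semidirect"
  then obtain x g where p: "p = (x, g)" "x \<in> carrier G" "g \<in> carrier A" by auto
  have "(act (inv\<^bsub>A\<^esub> g) (inv x), inv\<^bsub>A\<^esub> g) \<otimes>\<^bsub>semidirect\<^esub> p = \<one>\<^bsub>semidirect\<^esub>"
    using p by simp
  then show "\<exists>q\<in>carrier semidirect. q \<otimes>\<^bsub>semidirect\<^esub> p = \<one>\<^bsub>semidirect\<^esub>"
    using p by (intro bexI[of _ "(act (inv\<^bsub>A\<^esub> g) (inv x), inv\<^bsub>A\<^esub> g)"]) auto
qed (auto simp: m_assoc A.m_assoc act_compose act_one)

lemma semidirect_inv [simp]:
  assumes "x \<in> carrier G" "g \<in> carrier A"
  shows "inv\<^bsub>semidirect\<^esub> (x, g) = (act (inv\<^bsub>A\<^esub> g) (inv x), inv\<^bsub>A\<^esub> g)"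
  using assms by (intro group.inv_equality[OF semidirect_group]) auto

lemma affine_operator_group: "operator_group G semidirect affine_act"
proof (rule operator_group.intro[OF group_axioms semidirect_group], unfold_locales)
  fix p assume "p \<in> carrier semidirect"
  then show "affine_act p \<in> hom G G" by (auto simp: hom_def group_word)
next
  fix p q v assume "p \<in> carrier semidirect" "q \<in> carrier semidirect" "v \<in> carrier G"
  then show "affine_act (p \<otimes>\<^bsub>semidirect\<^esub> q) v = affine_act p (affine_act q v)"
    by (auto simp: group_word act_compose)
qed (simp add: act_one)

text \<open>
  Indexed from 0, so \<open>left_term k\<close> is the member with number \<open>k + 1\<close> of the left series.
\<close>

definition left_term :: "nat \<Rightarrow> 'a set" where
  "left_term k = commutator_series (carrier G) (carrier A) k"

lemma left_term_0: "left_term 0 = carrier G"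
  and left_term_Suc: "left_term (Suc k) = commutator (left_term k) (carrier A)"
  by (simp_all add: left_term_def)

lemma left_term_subgroup: "subgroup (left_term k) G"
  unfolding left_term_def by (rule commutator_series_subgroup[OF subgroup_self subset_refl])

lemma left_term_invariant: "invariant (carrier A) (left_term k)"
  unfolding left_term_def
  by (rule commutator_series_invariant[OF subgroup_self subset_refl subset_refl
        invariant_carrier[OF subset_refl] A.subgroup_normalizes_self[OF A.subgroup_self]])

lemma left_term_decreasing: "left_term (Suc k) \<subseteq> left_term k"
  unfolding left_term_Suc by (rule commutator_subset[OF left_term_subgroup left_term_invariant])

lemma left_term_antimono: "k \<le> l \<Longrightarrow> left_term l \<subseteq> left_term k"
  using lift_Suc_antimono_le[of left_term, OF left_term_decreasing] .

lemma left_term_normalized: "normalizes (left_term k) (left_term (Suc k))"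
  unfolding left_term_Suc by (rule commutator_normalized[OF left_term_subgroup subset_refl])

definition affine_term :: "nat \<Rightarrow> ('a \<times> 'b) set" where
  "affine_term k = left_term k \<times> carrier A"

lemma affine_term_subgroup: "subgroup (affine_term k) semidirect"
proof -
  note X = left_term_subgroup[of k]
  show ?thesis
  proof (rule group.subgroupI[OF semidirect_group])
    show "affine_term k \<subseteq> carrier semidirect"
      using subgroup.subset[OF X] by (auto simp: affine_term_def)
    show "affine_term k \<noteq> {}"
      using subgroup.one_closed[OF X] A.one_closed by (auto simp: affine_term_def)
    fix p assume "p \<in> affine_term k"
    then obtain x g where p: "p = (x, g)" "x \<in> left_term k" "g \<in> carrier A"
      by (auto simp: affine_term_def)
    show "inv\<^bsub>semidirect\<^esub> p \<in> affine_term k"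
      using p subgroup.mem_carrier[OF X p(2)]
        invariantD[OF left_term_invariant _ subgroup.m_inv_closed[OF X p(2)]]
      by (simp add: affine_term_def del: act_inv)
    fix q assume "q \<in> affine_term k"
    then obtain y h where q: "q = (y, h)" "y \<in> left_term k" "h \<in> carrier A"
      by (auto simp: affine_term_def)
    show "p \<otimes>\<^bsub>semidirect\<^esub> q \<in> affine_term k"
      using p q subgroup.m_closed[OF X p(2) invariantD[OF left_term_invariant p(3) q(2)]]
      by (simp add: affine_term_def)
  qed
qed

text \<open>
  The first component of the conjugate of \<open>(y, h)\<close> by \<open>(x, g)\<close> is \<open>(x g(y) x\<^sup>-\<^sup>1) (x h'(x)\<^sup>-\<^sup>1)\<close> with
  \<open>h' = g h g\<^sup>-\<^sup>1\<close>. The first factor lies in the next term of the series since that term is normal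
  in this one, the second since it is an inverted commutator.
\<close>

lemma affine_term_normalized:
  "group.normalizes semidirect (affine_term k) (affine_term (Suc k))"
proof -
  interpret S: group semidirect by (rule semidirect_group)
  note X = left_term_subgroup[of k] and Y = left_term_subgroup[of "Suc k"]
  show ?thesis
    unfolding S.normalizes_def
  proof (intro ballI)
    fix p q assume "p \<in> affine_term k" "q \<in> affine_term (Suc k)"
    then obtain x g y h where
      p: "p = (x, g)" "x \<in> left_term k" "g \<in> carrier A" and
      q: "q = (y, h)" "y \<in> left_term (Suc k)" "h \<in> carrier A"
      by (auto simp: affine_term_def)
    have c: "x \<in> carrier G" "y \<in> carrier G"
      using subgroup.mem_carrier[OF X p(2)] subgroup.mem_carrier[OF Y q(2)] .
    let ?h = "g \<otimes>\<^bsub>A\<^esub> h \<otimes>\<^bsub>A\<^esub> inv\<^bsub>A\<^esub> g"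
    have "p \<otimes>\<^bsub>semidirect\<^esub> q \<otimes>\<^bsub>semidirect\<^esub> inv\<^bsub>semidirect\<^esub> p
        = ((x \<otimes> act g y \<otimes> inv x) \<otimes> inv (act ?h x \<otimes> inv x), ?h)"
      using c p(3) q(3) by (simp add: p(1) q(1) group_word act_compose)
    moreover have "x \<otimes> act g y \<otimes> inv x \<in> left_term (Suc k)"
      using normalizesD[OF left_term_normalized p(2) invariantD[OF left_term_invariant p(3) q(2)]] .
    moreover have "act ?h x \<otimes> inv x \<in> left_term (Suc k)"
      unfolding left_term_Suc using p q by (intro commutatorI) auto
    ultimately show "p \<otimes>\<^bsub>semidirect\<^esub> q \<otimes>\<^bsub>semidirect\<^esub> inv\<^bsub>semidirect\<^esub> p \<in> affine_term (Suc k)"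
      using p q subgroup.m_closed[OF Y] subgroup.m_inv_closed[OF Y] by (simp add: affine_term_def)
  qed
qed

section \<open>Normality of the limit\<close>

text \<open>
  The group \<open>1 \<times> A\<close> climbs from the nil radical of \<open>X\<^sub>n \<rtimes> A\<close> to that of the full semidirect product,
  which is normal there and therefore swallows \<open>X\<^sub>1\<close>. The lower central series of \<open>X\<^sub>1\<close> is bounded by the
  commutator series of \<open>X\<^sub>1 \<rtimes> A\<close>, which descends into \<open>X\<^sub>n\<close>.
\<close>

theorem lower_central_subset_limit:
  assumes fin: "finite (carrier G)" and normal: "left_term n \<lhd> G"
  obtains m where "lower_central (G\<lparr>carrier := left_term 1\<rparr>) m \<subseteq> left_term n"
proof -
  interpret S: operator_group G semidirect affine_act by (rule affine_operator_group)
  define L where "L = left_term n"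
  have L: "subgroup L G" and Lnorm: "normalizes (carrier G) L"
    using normal by (simp_all add: L_def normal_iff_normalizes)
  have LG: "L \<subseteq> carrier G" by (rule subgroup.subset[OF L])
  note XG = subgroup.subset[OF left_term_subgroup]
  have Xnorm: "normalizes (left_term k) L" for k by (rule normalizes_subset[OF Lnorm XG])
  have Linv: "S.invariant (carrier semidirect) L"
    unfolding S.invariant_def
    using normalizesD[OF Lnorm] invariantD[OF left_term_invariant, of _ _ n] by (auto simp: L_def)
  have Dinv: "S.invariant (affine_term k) L" for k
    by (rule S.invariant_subset[OF Linv subgroup.subset[OF affine_term_subgroup]])
  have W: "subgroup (left_term j <#> L) G" for j
    by (rule subgroup_mult_normalized[OF left_term_subgroup L Xnorm])
  \<comment> \<open>Modulo \<open>L\<close>, conjugation by elements of \<open>left_term n\<close> is trivial and only the operators count.\<close>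
  have "S.commutator_series (carrier G) (affine_term n) j \<subseteq> left_term j <#> L" for j
  proof (induction j)
    case 0
    then show ?case using set_mult_incl(1)[OF left_term_subgroup[of 0] L] by (simp add: left_term_0)
  next
    case (Suc j)
    let ?W = "left_term (Suc j) <#> L"
    have "S.commutator (left_term j <#> L) (affine_term n) \<subseteq> ?W"
    proof (rule S.commutator_least[OF W])
      fix d t assume "d \<in> affine_term n" and t: "t \<in> left_term j <#> L"
      then obtain x g where d: "d = (x, g)" "x \<in> L" "g \<in> carrier A"
        by (auto simp: affine_term_def L_def)
      have c: "x \<in> carrier G" "t \<in> carrier G"
        using subgroup.mem_carrier[OF L d(2)] subgroup.mem_carrier[OF W t] .
      have "act g t \<otimes> inv t \<in> ?W"
        unfolding left_term_Suc
        using commutator_of_product[OF d(3) subset_refl left_term_subgroup L Xnorm _ t]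
          left_term_invariant[of n] by (simp add: L_def)
      moreover have "x \<in> ?W" "t \<otimes> inv x \<otimes> inv t \<in> ?W"
        using d(2) normalizesD[OF Lnorm c(2) subgroup.m_inv_closed[OF L d(2)]]
          set_mult_incl(2)[OF left_term_subgroup L] by auto
      ultimately have "x \<otimes> (act g t \<otimes> inv t) \<otimes> (t \<otimes> inv x \<otimes> inv t) \<in> ?W"
        using subgroup.m_closed[OF W] by simp
      then show "affine_act d t \<otimes> inv t \<in> ?W"
        using c d(3) by (simp add: d(1) group_word)
    qed
    then show ?case using S.commutator_mono[OF Suc subset_refl, of "affine_term n"] by simp
  qed
  from this[of n] have "S.commutator_series (carrier G) (affine_term n) n \<subseteq> L"
    using set_mult_least[OF L, of L L] by (simp add: L_def)
  then have "S.nil_mod L (affine_term n)" by (auto simp: S.nil_mod_def)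
  then have "S.nil_normal L (affine_term n) (affine_term n)"
    by (simp add: S.nil_normal_def affine_term_subgroup S.A.subgroup_normalizes_self)
  then have base: "affine_term n \<subseteq> S.nil_radical L (affine_term n)" by (rule S.nil_radical_upper)
  \<comment> \<open>Descent of the index from \<open>n\<close> to 0 along the subnormal chain.\<close>
  have "{\<one>} \<times> carrier A \<subseteq> S.nil_radical L (affine_term (n - k))" for k
  proof (induction k)
    case 0
    then show ?case
      using base subgroup.one_closed[OF left_term_subgroup, of n] by (auto simp: affine_term_def)
  next
    case (Suc k)
    show ?case
    proof (cases "n - k")
      case 0
      then show ?thesis using Suc by simp
    next
      case (Suc j)
      then have j: "n - Suc k = j" by simp
      have "affine_term (Suc j) \<subseteq> affine_term j"
        using left_term_decreasing by (auto simp: affine_term_def)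
      from S.nil_radical_mono[OF fin normal[folded L_def] affine_term_subgroup affine_term_subgroup this
          affine_term_normalized Dinv]
      show ?thesis using Suc.IH unfolding j Suc by blast
    qed
  qed
  from this[of n] have AR: "{\<one>} \<times> carrier A \<subseteq> S.nil_radical L (affine_term 0)" by simp
  define R where "R = S.nil_radical L (affine_term 0)"
  have R: "subgroup R semidirect"
    unfolding R_def by (rule S.nil_radical_subgroup[OF affine_term_subgroup])
  have Rnorm: "S.A.normalizes (affine_term 0) R"
    unfolding R_def by (rule S.nil_radical_normalized[OF affine_term_subgroup affine_term_subgroup
          S.A.subgroup_normalizes_self[OF affine_term_subgroup] Dinv])
  \<comment> \<open>The elements of \<open>G\<close> whose inner automorphisms belong to the radical.\<close>
  define V where "V = {y \<in> carrier G. (y, \<one>\<^bsub>A\<^esub>) \<in> R}"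
  have V: "subgroup V G"
  proof (rule subgroupI)
    show "V \<noteq> {}" using subgroup.one_closed[OF R] by (auto simp: V_def)
    fix a assume a: "a \<in> V"
    then show "inv a \<in> V" using subgroup.m_inv_closed[OF R, of "(a, \<one>\<^bsub>A\<^esub>)"]
      by (auto simp: V_def act_one)
    fix b assume "b \<in> V"
    then show "a \<otimes> b \<in> V"
      using a subgroup.m_closed[OF R, of "(a, \<one>\<^bsub>A\<^esub>)" "(b, \<one>\<^bsub>A\<^esub>)"] by (auto simp: V_def act_one)
  qed (auto simp: V_def)
  have "left_term 1 \<subseteq> V"
    unfolding One_nat_def left_term_Suc left_term_0
  proof (rule commutator_least[OF V])
    fix g x assume g: "g \<in> carrier A" and x: "x \<in> carrier G"
    have gR: "(\<one>, g) \<in> R" using AR g by (auto simp: R_def)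
    have "(x, \<one>\<^bsub>A\<^esub>) \<in> affine_term 0" using x by (simp add: affine_term_def left_term_0)
    from S.A.normalizesD[OF Rnorm this gR] have "(x \<otimes> inv (act g x), g) \<in> R"
      using x g by (simp add: act_one)
    from subgroup.m_closed[OF R this subgroup.m_inv_closed[OF R gR]]
    have "(x \<otimes> inv (act g x), \<one>\<^bsub>A\<^esub>) \<in> R" using x g by simp
    then have "x \<otimes> inv (act g x) \<in> V" using x g by (simp add: V_def)
    from subgroup.m_inv_closed[OF V this] show "act g x \<otimes> inv x \<in> V"
      using x g by (simp add: group_word)
  qed
  then have "affine_term 1 \<subseteq> R"
  proof (intro subsetI)
    fix p assume sub: "left_term 1 \<subseteq> V" and "p \<in> affine_term 1"
    then obtain y g where p: "p = (y, g)" "y \<in> V" "g \<in> carrier A" by (auto simp: affine_term_def)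
    then have "(y, \<one>\<^bsub>A\<^esub>) \<otimes>\<^bsub>semidirect\<^esub> (\<one>, g) \<in> R"
      using AR by (intro subgroup.m_closed[OF R]) (auto simp: V_def R_def)
    then show "p \<in> R" using p by (simp add: V_def act_one)
  qed
  then have "S.nil_mod L (affine_term 1)"
    using S.nil_mod_nil_radical[OF fin normal[folded L_def] affine_term_subgroup Dinv, of 0]
    unfolding R_def by (rule S.nil_mod_subset[rotated])
  then obtain m where m: "S.commutator_series (carrier G) (affine_term 1) m \<subseteq> L"
    by (auto simp: S.nil_mod_def)
  define C where "C = lower_central (G\<lparr>carrier := left_term 1\<rparr>)"
  have "C i \<subseteq> S.commutator_series (carrier G) (affine_term 1) i" for i
  proof (induction i)
    case 0
    then show ?case using XG by (simp add: C_def)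
  next
    case (Suc i)
    let ?S = "S.commutator_series (carrier G) (affine_term 1) i"
    have sub: "subgroup (S.commutator ?S (affine_term 1)) G"
      using S.commutator_series_subgroup[OF subgroup_self subgroup.subset[OF affine_term_subgroup], of 1 "Suc i"]
      by simp
    have CG: "C i \<subseteq> left_term 1"
      unfolding C_def using lower_central_subgroup[OF left_term_subgroup] by blast
    have "C (Suc i) \<subseteq> S.commutator ?S (affine_term 1)"
      unfolding C_def lower_central_Suc_subgroup[OF left_term_subgroup CG[unfolded C_def]]
    proof (rule generate_subgroup_incl[OF _ sub], clarify)
      fix x y assume x: "x \<in> lower_central (G\<lparr>carrier := left_term 1\<rparr>) i" and y: "y \<in> left_term 1"
      have c: "x \<in> carrier G" "y \<in> carrier G" using x y CG XG by (auto simp: C_def)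
      have "affine_act (y, \<one>\<^bsub>A\<^esub>) x \<otimes> inv x \<in> S.commutator ?S (affine_term 1)"
        using x y Suc by (intro S.commutatorI) (auto simp: affine_term_def C_def)
      from subgroup.m_inv_closed[OF sub this]
      show "x \<otimes> y \<otimes> inv x \<otimes> inv y \<in> S.commutator ?S (affine_term 1)"
        using c by (simp add: act_one group_word)
    qed
    then show ?case by simp
  qed
  then have "C m \<subseteq> L" using m by blast
  then show thesis by (intro that) (simp add: C_def L_def)
qed

text \<open>
  Normality is propagated from \<open>X\<^sub>k\<^sub>+\<^sub>1\<close> to \<open>X\<^sub>k\<close>: the final term \<open>T\<close> of the series of \<open>X\<^sub>k\<close> under
  \<open>X\<^sub>k\<^sub>+\<^sub>1 \<rtimes> A\<close> is normalised by \<open>X\<^sub>k\<close>, and it is shown to equal \<open>L\<close> by descending through the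
  lower central series of \<open>X\<^sub>1\<close>. At each stage the operators alone can reduce \<open>T\<close> modulo \<open>\<gamma>\<^sub>i\<^sub>+\<^sub>1\<close>, since
  commutators of \<open>L \<gamma>\<^sub>i\<close> with \<open>X\<^sub>k\<^sub>+\<^sub>1\<close> already lie in \<open>L \<gamma>\<^sub>i\<^sub>+\<^sub>1\<close>.
\<close>

theorem limit_normal:
  assumes fin: "finite (carrier G)" and lim: "\<And>m. n \<le> m \<Longrightarrow> left_term m = left_term n"
    and central: "lower_central (G\<lparr>carrier := left_term 1\<rparr>) m \<subseteq> left_term n"
  shows "left_term n \<lhd> G"
proof -
  interpret S: operator_group G semidirect affine_act by (rule affine_operator_group)
  define L where "L = left_term n"
  have L: "subgroup L G" unfolding L_def by (rule left_term_subgroup)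
  have LX: "L \<subseteq> left_term j" for j
    using left_term_antimono[of j n] lim[of j] by (cases "j \<le> n") (auto simp: L_def)
  have LL: "commutator L (carrier A) = L"
    using lim[of "Suc n"] by (simp add: L_def left_term_Suc)
  note XG = subgroup.subset[OF left_term_subgroup]
  note DS = subgroup.subset[OF affine_term_subgroup]
  define C where "C = lower_central (G\<lparr>carrier := left_term 1\<rparr>)"
  have C: "subgroup (C i) G" and CN: "C i \<subseteq> left_term 1" for i
    using lower_central_subgroup[OF left_term_subgroup] by (simp_all add: C_def)
  have Cnorm: "normalizes (carrier G) (C i)" for i
    unfolding C_def using left_term_normalized[of 0]
    by (intro lower_central_normalized[OF left_term_subgroup subset_refl]) (simp add: left_term_0)
  have Cinv: "invariant (carrier A) (C i)" for i
    unfolding invariant_def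
  proof (induction i)
    case 0
    then show ?case using left_term_invariant[of 1] by (simp add: C_def invariant_def)
  next
    case (Suc i)
    let ?K = "{x \<otimes> y \<otimes> inv x \<otimes> inv y | x y. x \<in> C i \<and> y \<in> left_term 1}"
    have gen: "C (Suc i) = generate G ?K"
      using lower_central_Suc_subgroup[OF left_term_subgroup CN[unfolded C_def]] by (simp add: C_def)
    have "invariant (carrier A) (generate G ?K)"
    proof (rule invariant_generate[OF _ subset_refl])
      show "?K \<subseteq> carrier G"
        using subgroup.subset[OF C] XG by (auto intro!: m_closed inv_closed)
      fix d k assume d: "d \<in> carrier A" and "k \<in> ?K"
      then obtain x y where k: "k = x \<otimes> y \<otimes> inv x \<otimes> inv y" "x \<in> C i" "y \<in> left_term 1" by blast
      have c: "x \<in> carrier G" "y \<in> carrier G" using k subgroup.subset[OF C] XG by auto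
      have "act d k = act d x \<otimes> act d y \<otimes> inv (act d x) \<otimes> inv (act d y)"
        using c d by (simp add: k(1))
      moreover have "act d x \<in> C i" "act d y \<in> left_term 1"
        using Suc d k invariantD[OF left_term_invariant] by auto
      ultimately show "act d k \<in> generate G ?K" by (blast intro: generate.incl)
    qed
    then show ?case unfolding gen invariant_def .
  qed
  have step: "normalizes (left_term k) L" if norm: "normalizes (left_term (Suc k)) L" for k
  proof -
    define D where "D = affine_term (Suc k)"
    have D: "subgroup D semidirect" and DE: "D \<subseteq> affine_term k"
      using affine_term_subgroup left_term_decreasing by (auto simp: D_def affine_term_def)
    have DSd: "D \<subseteq> carrier semidirect" by (rule subgroup.subset[OF D])
    have Xinv: "S.invariant (affine_term k) (left_term k)"
      unfolding S.invariant_def affine_term_def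
      using normalizesD[OF subgroup_normalizes_self[OF left_term_subgroup]]
        invariantD[OF left_term_invariant] by auto
    have finX: "finite (left_term k)" using fin XG finite_subset by blast
    obtain r where r: "\<And>s. r \<le> s \<Longrightarrow>
        S.commutator_series (left_term k) D s = S.commutator_series (left_term k) D r"
      using S.commutator_series_stable[OF left_term_subgroup D S.invariant_subset[OF Xinv DE] finX] by blast
    define T where "T = S.commutator_series (left_term k) D r"
    have T: "subgroup T G" unfolding T_def by (rule S.commutator_series_subgroup[OF left_term_subgroup DSd])
    have TG: "T \<subseteq> carrier G" by (rule subgroup.subset[OF T])
    have TD: "S.commutator T D = T" using r[of "Suc r"] by (simp add: T_def)
    have Tinv: "S.invariant (affine_term k) T"
      unfolding T_def by (rule S.commutator_series_invariant[OF left_term_subgroup DSd DS Xinv])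
        (simp add: D_def affine_term_normalized)
    have one: "(\<one>, g) \<in> affine_term j" if "g \<in> carrier A" for g j
      using that subgroup.one_closed[OF left_term_subgroup] by (simp add: affine_term_def)
    have gT: "act g t \<in> T" if "g \<in> carrier A" "t \<in> T" for g t
      using S.invariantD[OF Tinv one[OF that(1)] that(2)] that TG by auto
    have "L \<subseteq> S.commutator_series (left_term k) D s" for s
    proof (induction s)
      case 0
      then show ?case using LX by simp
    next
      case (Suc s)
      have sub: "subgroup (S.commutator L D) G"
        by (rule S.commutator_subgroup[OF subgroup.subset[OF L] DSd])
      have "commutator L (carrier A) \<subseteq> S.commutator L D"
      proof (rule commutator_least[OF sub])
        fix g t assume gt: "g \<in> carrier A" "t \<in> L"
        have "affine_act (\<one>, g) t \<otimes> inv t \<in> S.commutator L D"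
          using gt one by (intro S.commutatorI) (auto simp: D_def)
        then show "act g t \<otimes> inv t \<in> S.commutator L D"
          using gt subgroup.mem_carrier[OF L] by simp
      qed
      then show ?case using LL S.commutator_mono[OF Suc subset_refl, of D] by auto
    qed
    then have LT: "L \<subseteq> T" by (simp add: T_def)
    have TX: "T \<subseteq> left_term (Suc k)"
    proof -
      have "S.commutator (left_term k) D \<subseteq> left_term (Suc k)"
      proof (rule S.commutator_least[OF left_term_subgroup])
        fix d t assume "d \<in> D" and t: "t \<in> left_term k"
        then obtain x g where d: "d = (x, g)" "x \<in> left_term (Suc k)" "g \<in> carrier A"
          by (auto simp: D_def affine_term_def)
        have c: "x \<in> carrier G" "t \<in> carrier G"
          using subgroup.mem_carrier[OF left_term_subgroup] d t by auto
        have "act g t \<otimes> inv t \<in> left_term (Suc k)"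
          unfolding left_term_Suc by (rule commutatorI[OF d(3) t])
        moreover have "t \<otimes> inv x \<otimes> inv t \<in> left_term (Suc k)"
          using normalizesD[OF left_term_normalized t subgroup.m_inv_closed[OF left_term_subgroup d(2)]] .
        ultimately have "x \<otimes> (act g t \<otimes> inv t) \<otimes> (t \<otimes> inv x \<otimes> inv t) \<in> left_term (Suc k)"
          using d(2) subgroup.m_closed[OF left_term_subgroup] by simp
        then show "affine_act d t \<otimes> inv t \<in> left_term (Suc k)"
          using c d(3) by (simp add: d(1) group_word)
      qed
      moreover have "T \<subseteq> left_term k"
        unfolding T_def
        using S.commutator_series_decreasing[OF left_term_subgroup D S.invariant_subset[OF Xinv DE]]
          lift_Suc_antimono_le[of "S.commutator_series (left_term k) D" 0 r] by simp
      ultimately show ?thesis using TD S.commutator_mono[of T "left_term k" D D] by blast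
    qed
    have WL: "subgroup (left_term j <#> C i) G" for i j
      by (rule subgroup_mult_normalized[OF left_term_subgroup C normalizes_subset[OF Cnorm XG]])
    have "T \<subseteq> L <#> C i" for i
    proof (induction i)
      case 0
      have "T \<subseteq> C 0" using TX left_term_antimono[of 1 "Suc k"] by (simp add: C_def)
      then show ?case using set_mult_incl(2)[OF L C] by blast
    next
      case (Suc i)
      have "T \<subseteq> left_term j <#> C (Suc i)" for j
      proof (induction j)
        case 0
        then show ?case using TG set_mult_incl(1)[OF left_term_subgroup[of 0] C] by (force simp: left_term_0)
      next
        case (Suc j)
        let ?W = "left_term (Suc j) <#> C (Suc i)"
        have W: "subgroup ?W G" by (rule WL)
        have "S.commutator T D \<subseteq> ?W"
        proof (rule S.commutator_least[OF W])
          fix d t assume "d \<in> D" and t: "t \<in> T"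
          then obtain x g where d: "d = (x, g)" "x \<in> left_term (Suc k)" "g \<in> carrier A"
            by (auto simp: D_def affine_term_def)
          have gt: "act g t \<otimes> inv t \<in> ?W"
            unfolding left_term_Suc
            using t Suc by (intro commutator_of_product[OF d(3) subset_refl left_term_subgroup C
                  normalizes_subset[OF Cnorm XG] Cinv]) blast
          obtain l s where ls: "l \<in> L" "s \<in> C i" "act g t = l \<otimes> s"
            using gT[OF d(3) t] \<open>T \<subseteq> L <#> C i\<close> by (blast elim: set_mult_memE)
          have x1: "x \<in> left_term 1" using d(2) left_term_antimono[of 1 "Suc k"] by auto
          have c: "x \<in> carrier G" "t \<in> carrier G" "l \<in> carrier G" "s \<in> carrier G"
            using d(2) t TG ls subgroup.mem_carrier[OF L] subgroup.mem_carrier[OF C]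
              subgroup.mem_carrier[OF left_term_subgroup] by auto
          have "x \<otimes> l \<otimes> inv x \<otimes> inv l \<in> L"
            by (rule subgroup.m_closed[OF L normalizesD[OF norm d(2) ls(1)] subgroup.m_inv_closed[OF L ls(1)]])
          then have a: "x \<otimes> l \<otimes> inv x \<otimes> inv l \<in> ?W"
            using LX set_mult_incl(1)[OF left_term_subgroup C] by blast
          have "inv (s \<otimes> x \<otimes> inv s \<otimes> inv x) \<in> C (Suc i)"
            using lower_central_commutator[OF left_term_subgroup ls(2)[unfolded C_def] x1]
            by (intro subgroup.m_inv_closed[OF C]) (simp add: C_def)
          from normalizesD[OF Cnorm c(3) this]
          have b: "l \<otimes> inv (s \<otimes> x \<otimes> inv s \<otimes> inv x) \<otimes> inv l \<in> ?W"
            using set_mult_incl(2)[OF left_term_subgroup C] by blast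
          \<comment> \<open>With \<open>g(t) = l s\<close>: \<open>x g(t) x\<^sup>-\<^sup>1 t\<^sup>-\<^sup>1 = [x, l] [x, s]\<^sup>l (g(t) t\<^sup>-\<^sup>1)\<close>, where \<open>[x, l] \<in> L\<close> and \<open>[x, s] \<in> \<gamma>\<^sub>i\<^sub>+\<^sub>1\<close>.\<close>
          have "affine_act d t \<otimes> inv t = (x \<otimes> l \<otimes> inv x \<otimes> inv l)
              \<otimes> (l \<otimes> inv (s \<otimes> x \<otimes> inv s \<otimes> inv x) \<otimes> inv l) \<otimes> (act g t \<otimes> inv t)"
            using c by (simp add: d(1) ls(3) group_word)
          also have "\<dots> \<in> ?W" by (rule subgroup.m_closed[OF W subgroup.m_closed[OF W a b] gt])
          finally show "affine_act d t \<otimes> inv t \<in> ?W" .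
        qed
        then show ?case by (simp add: TD)
      qed
      from this[of n] show ?case by (simp add: L_def)
    qed
    from this[of m] have "T \<subseteq> L"
      using set_mult_least[OF L subset_refl, of "C m"] central by (auto simp: C_def L_def)
    then have TL: "T = L" using LT by blast
    show ?thesis
      unfolding normalizes_def
    proof (intro ballI)
      fix x t assume x: "x \<in> left_term k" and t: "t \<in> L"
      have "affine_act (x, \<one>\<^bsub>A\<^esub>) t \<in> T"
        using x t TL by (intro S.invariantD[OF Tinv]) (simp_all add: affine_term_def)
      then show "x \<otimes> t \<otimes> inv x \<in> L"
        using t subgroup.mem_carrier[OF L] by (simp add: act_one TL)
    qed
  qed
  \<comment> \<open>Descent of the index, starting from \<open>left_term n = L\<close>, which normalises itself.\<close>
  have "normalizes (left_term (n - k)) L" for k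
  proof (induction k)
    case 0
    then show ?case by (simp add: L_def subgroup_normalizes_self left_term_subgroup)
  next
    case (Suc k)
    then show ?case
      using step[of "n - Suc k"] by (cases "k < n") (simp_all add: Suc_diff_Suc)
  qed
  from this[of n] show ?thesis
    using L by (simp add: normal_iff_normalizes left_term_0 L_def)
qed

end

theorem (in operator_group) limit_normal_iff:
  assumes "finite (carrier G)" and "\<And>m. n \<le> m \<Longrightarrow> left_term m = left_term n"
  shows "left_term n \<lhd> G \<longleftrightarrow> (\<exists>m. lower_central (G\<lparr>carrier := left_term 1\<rparr>) m \<subseteq> left_term n)"
  using lower_central_subset_limit[OF assms(1)] limit_normal[OF assms] by metis

section \<open>Skew braces as groups with operators\<close>

context skew_brace begin

definition lambda :: "'a \<Rightarrow> 'a \<Rightarrow> 'a" where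
  "lambda a b = \<ominus> a \<oplus> a \<otimes> b"

lemma minus_closed [simp]: "a \<in> carrier B \<Longrightarrow> \<ominus> a \<in> carrier B"
  using add.inv_closed by (simp add: a_inv_def)

lemma plus_closed [simp]: "a \<in> carrier B \<Longrightarrow> b \<in> carrier B \<Longrightarrow> a \<oplus> b \<in> carrier B"
  using add.m_closed by simp

lemma zero_closed [simp]: "\<zero> \<in> carrier B"
  using add.one_closed by simp

lemmas add_word = add.group_word[simplified, folded a_inv_def]

lemma add_neutral [simp]:
  assumes "a \<in> carrier B"
  shows "\<zero> \<oplus> a = a" "a \<oplus> \<zero> = a" "\<ominus> a \<oplus> a = \<zero>" "a \<oplus> \<ominus> a = \<zero>" "\<ominus> (\<ominus> a) = a"
  using assms add.l_one add.r_one add.l_inv add.r_inv add.inv_inv by (simp_all add: a_inv_def)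

text \<open>
  Distributing over \<open>0 + 0\<close> gives \<open>a \<cdot> 0 = a\<close>; take \<open>a\<close> to be the multiplicative identity.
\<close>

lemma zero_eq_one: "\<zero> = \<one>"
proof -
  have "a \<otimes> \<zero> = a" if a: "a \<in> carrier B" for a
  proof -
    have "a \<otimes> \<zero> = a \<otimes> \<zero> \<oplus> (\<ominus> a \<oplus> a \<otimes> \<zero>)"
      using brace_distrib[OF a zero_closed zero_closed] a by (simp add: add_word)
    then have "\<ominus> (a \<otimes> \<zero>) \<oplus> a \<otimes> \<zero> = \<ominus> (a \<otimes> \<zero>) \<oplus> (a \<otimes> \<zero> \<oplus> (\<ominus> a \<oplus> a \<otimes> \<zero>))" by simp
    then have "\<zero> = \<ominus> a \<oplus> a \<otimes> \<zero>" using a by (simp add: add_word)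
    then have "a \<oplus> \<zero> = a \<oplus> (\<ominus> a \<oplus> a \<otimes> \<zero>)" by simp
    then show ?thesis using a by (simp add: add_word)
  qed
  from this[of \<one>] show ?thesis by simp
qed

lemma mult_minus:
  assumes a: "a \<in> carrier B" and b: "b \<in> carrier B"
  shows "a \<otimes> (\<ominus> b) = a \<oplus> (\<ominus> (a \<otimes> b) \<oplus> a)"
proof -
  have "a = a \<otimes> (b \<oplus> \<ominus> b)" using a b by (simp add: zero_eq_one)
  also have "\<dots> = a \<otimes> b \<oplus> \<ominus> a \<oplus> a \<otimes> (\<ominus> b)"
    using a b by (intro brace_distrib) auto
  finally have "a \<oplus> (\<ominus> (a \<otimes> b) \<oplus> a)
      = a \<oplus> (\<ominus> (a \<otimes> b) \<oplus> (a \<otimes> b \<oplus> \<ominus> a \<oplus> a \<otimes> (\<ominus> b)))" by simp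
  then show ?thesis using a b by (simp add: add_word)
qed

text \<open>
  Brace distributivity says that every \<open>\<lambda>\<^sub>a\<close> is an additive homomorphism; multiplicativity in
  \<open>a\<close> follows with the formula \<open>a \<cdot> (-b) = a - a \<cdot> b + a\<close>.
\<close>

lemma lambda_operator_group: "operator_group (add_monoid B) B lambda"
proof (rule operator_group.intro[OF add.group_axioms group_axioms], unfold_locales)
  fix a assume a: "a \<in> carrier B"
  show "lambda a \<in> hom (add_monoid B) (add_monoid B)"
    using a by (auto simp: hom_def lambda_def brace_distrib add_word)
next
  fix a b x assume "a \<in> carrier B" "b \<in> carrier B" "x \<in> carrier (add_monoid B)"
  then show "lambda (a \<otimes> b) x = lambda a (lambda b x)"
    by (simp add: lambda_def brace_distrib mult_minus add_word m_assoc)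
next
  fix x assume "x \<in> carrier (add_monoid B)"
  moreover have "\<ominus> \<zero> = \<zero>" using add.inv_one by (simp add: a_inv_def)
  then have "\<ominus> \<one> = \<zero>" by (simp add: zero_eq_one)
  ultimately show "lambda \<one> x = x" by (simp add: lambda_def)
qed

lemma left_series_eq_left_term:
  "left_series B (Suc k) = operator_group.left_term (add_monoid B) B lambda k"
proof -
  interpret op: operator_group "add_monoid B" B lambda by (rule lambda_operator_group)
  have "star B s t = lambda s t \<oplus> inv\<^bsub>add_monoid B\<^esub> t" for s t
    by (simp add: star_def lambda_def a_inv_def)
  then show ?thesis
    by (induction k) (simp_all add: op.left_term_0 op.left_term_Suc set_star_def op.commutator_def)
qed

end

theorem theorem4p3:
  fixes B :: "('a, 'm) ring_scheme"
  assumes "skew_brace B"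
    and "finite (carrier B)"
  shows "left_series_limit B \<lhd> add_monoid B \<longleftrightarrow>
    nilpotent_residual ((add_monoid B)\<lparr>carrier := left_series B 2\<rparr>) \<subseteq> left_series_limit B"
proof -
  interpret skew_brace B by (rule assms(1))
  interpret op: operator_group "add_monoid B" B lambda by (rule lambda_operator_group)
  have fin: "finite (carrier (add_monoid B))" using assms(2) by simp
  obtain n where n: "\<And>m. n \<le> m \<Longrightarrow> op.left_term m = op.left_term n"
    using decreasing_sets_stabilize[of op.left_term, OF op.left_term_decreasing] fin
    by (auto simp: op.left_term_0)
  have sub: "op.left_term n \<subseteq> op.left_term k" for k
    using op.left_term_antimono[of k n] n[of k] by (cases "k \<le> n") auto
  have "left_series_limit B = (\<Inter>k. op.left_term k)"
    unfolding left_series_limit_def left_series_eq_left_term[symmetric]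
    by (auto simp: Suc_le_eq gr0_conv_Suc)
  also have "\<dots> = op.left_term n" using sub by blast
  finally have limit: "left_series_limit B = op.left_term n" .
  have second: "left_series B 2 = op.left_term 1"
    using left_series_eq_left_term[of 1] by (simp add: numeral_2_eq_2)
  interpret N: group "(add_monoid B)\<lparr>carrier := op.left_term 1\<rparr>"
    by (rule add.subgroup_imp_group[OF op.left_term_subgroup])
  have "finite (carrier ((add_monoid B)\<lparr>carrier := op.left_term 1\<rparr>))"
    using fin subgroup.subset[OF op.left_term_subgroup[of 1]] by (auto intro: finite_subset)
  from N.nilpotent_residual_subset_iff[OF this] op.limit_normal_iff[OF fin n]
  show ?thesis unfolding limit second by simp
qed

end
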